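(* Fix $\alpha<2$, $p\in(0,1]$, and $\theta>0$. Let $\mu=TS^p_\alpha(R,b)$ be a $p$-tempered $\alpha$-stable distribution on $\mathbb R^d$ with Rosi\'nski measure $R$ and shift $b$. 1. If $\alpha\in(0,2)$ then $$\int_{\mathbb R^d}e^{\theta|x|^p}\mu(dx)<\infty\iff R(\{|x|>\theta^{-1/p}\})=0.$$ 2. If $\alpha<0$ then $\int_{\mathbb R^d}e^{\theta|x|^p}\mu(dx)<\infty$ if and only if $$R(\{|x|\ge\theta^{-1/p}\})=0\quad\text{and}\quad\int_{0<|x|^{-p}-\theta<1}(|x|^{-p}-\theta)^{\alpha/p}\,R(dx)<\infty.$$ 3. If $\alpha=0$ then $\int_{\mathbb R^d}e^{\theta|x|^p}\mu(dx)<\infty$ if and only if $$R(\{|x|\ge\theta^{-1/p}\})=0\quad\text{and}\quad\int_{0<|x|^{-p}-\theta<1}\left|\log(|x|^{-p}-\theta)\right|R(dx)<\infty.$$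
   Context: $ID(0,M,b)$ is the infinitely divisible distribution on $\mathbb R^d$ with no Gaussian part, L\'evy measure $M$, and characteristic function $\exp\left\{i\langle b,z\rangle+\int_{\mathbb R^d}\left(e^{i\langle z,x\rangle}-1-i\frac{\langle z,x\rangle}{1+|x|^2}\right)M(dx)\right\}$. For $\alpha<2$, $p>0$, $TS^p_\alpha(R,b)$ denotes the $p$-tempered $\alpha$-stable distribution with Rosi\'nski measure $R$ and shift $b\in\mathbb R^d$, i.e. $ID(0,M,b)$ with $$M(A)=\int_{\mathbb R^d}\int_0^\infty1_A(tx)\,t^{-1-\alpha}e^{-t^p}\,dt\,R(dx),\qquad A\in\mathfrak B(\mathbb R^d),$$ where $R$ is a Borel measure on $\mathbb R^d$ with $R(\{0\})=0$ and $\int(|x|^2\wedge|x|^\alpha)R(dx)<\infty$ if $\alpha\in(0,2)$, $\int(|x|^2\wedge[1+\log^+|x|])R(dx)<\infty$ if $\alpha=0$, $\int(|x|^2\wedge1)R(dx)<\infty$ if $\alpha<0$. (These are exactly the conditions under which $M$ is a L\'evy measure when $R\ne 0$, and $M$ determines $R$.) *)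

theory Defs
  imports "HOL-Probability.Probability"
begin

text \<open>The library's \<^const>\<open>char\<close> covers only measures on the real line; this is its
  analogue on a Euclidean space.\<close>

definition char_fun :: "'a::euclidean_space measure \<Rightarrow> 'a \<Rightarrow> complex" where
  "char_fun \<mu> z = (CLINT x|\<mu>. iexp (z \<bullet> x))"

definition levy_measure :: "'a::euclidean_space measure \<Rightarrow> bool" where
  "levy_measure M \<longleftrightarrow>
     sets M = sets borel \<and> emeasure M {0} = 0 \<and>
     (\<integral>\<^sup>+x. ennreal (min ((norm x)\<^sup>2) 1) \<partial>M) < \<infinity>"

definition is_ID0 :: "'a::euclidean_space measure \<Rightarrow> 'a \<Rightarrow> 'a measure \<Rightarrow> bool" where
  "is_ID0 M b \<mu> \<longleftrightarrow>
     levy_measure M \<and> prob_space \<mu> \<and> sets \<mu> = sets borel \<and>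
     (\<forall>z. char_fun \<mu> z =
        exp (\<i> * complex_of_real (b \<bullet> z) +
             (CLINT x|M. iexp (z \<bullet> x) - 1 -
                \<i> * complex_of_real ((z \<bullet> x) / (1 + (norm x)\<^sup>2)))))"

text \<open>At the origin, \<open>0 powr \<alpha> = 0\<close> and \<open>ln 0 = 0\<close>; these conventions are
  harmless because the origin is a null set of the measure.\<close>

definition rosinski_measure :: "real \<Rightarrow> 'a::euclidean_space measure \<Rightarrow> bool" where
  "rosinski_measure \<alpha> R \<longleftrightarrow>
     sets R = sets borel \<and> emeasure R {0} = 0 \<and>
     (0 < \<alpha> \<longrightarrow>
        (\<integral>\<^sup>+x. ennreal (min ((norm x)\<^sup>2) (norm x powr \<alpha>)) \<partial>R) < \<infinity>) \<and>
     (\<alpha> = 0 \<longrightarrow>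
        (\<integral>\<^sup>+x. ennreal (min ((norm x)\<^sup>2) (1 + max 0 (ln (norm x)))) \<partial>R) < \<infinity>) \<and>
     (\<alpha> < 0 \<longrightarrow>
        (\<integral>\<^sup>+x. ennreal (min ((norm x)\<^sup>2) 1) \<partial>R) < \<infinity>)"

definition TS_levy :: "real \<Rightarrow> real \<Rightarrow> 'a::euclidean_space measure \<Rightarrow> 'a measure" where
  "TS_levy p \<alpha> R = measure_of UNIV (sets borel)
     (\<lambda>A. \<integral>\<^sup>+x. (\<integral>\<^sup>+t\<in>{0<..}. indicator A (t *\<^sub>R x) *
              ennreal (t powr (-1 - \<alpha>) * exp (- (t powr p))) \<partial>lborel) \<partial>R)"

lemma sets_TS_levy: "sets (TS_levy p \<alpha> R) = sets borel"
  unfolding TS_levy_def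
  using sets.sigma_sets_eq[of "borel :: 'a measure"] by simp

text \<open>\<^const>\<open>measure_of\<close> returns the null measure when the given set function is not
  countably additive; this does not happen here.\<close>

lemma emeasure_TS_levy:
  fixes R :: "'a::euclidean_space measure"
  assumes R: "sets R = sets borel" and A: "A \<in> sets borel"
  shows "emeasure (TS_levy p \<alpha> R) A =
    (\<integral>\<^sup>+x. (\<integral>\<^sup>+t\<in>{0<..}. indicator A (t *\<^sub>R x) *
       ennreal (t powr (-1 - \<alpha>) * exp (- (t powr p))) \<partial>lborel) \<partial>R)"
proof -
  note R[measurable_cong]
  define g :: "'a set \<Rightarrow> 'a \<Rightarrow> real \<Rightarrow> ennreal" where
    "g B x t = indicator B (t *\<^sub>R x) *
       ennreal (t powr (-1 - \<alpha>) * exp (- (t powr p))) * indicator {0<..} t" for B x t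
  have g_meas: "case_prod (g B) \<in> borel_measurable (R \<Otimes>\<^sub>M lborel)" if [measurable]: "B \<in> sets borel" for B
    unfolding g_def by measurable
  have inner: "(\<lambda>x. \<integral>\<^sup>+t. g B x t \<partial>lborel) \<in> borel_measurable R" if "B \<in> sets borel" for B
    using lborel.borel_measurable_nn_integral[OF g_meas[OF that]] by simp
  have g_meas1: "g B x \<in> borel_measurable lborel" if [measurable]: "B \<in> sets borel" for B x
    unfolding g_def by measurable
  let ?m = "\<lambda>B. \<integral>\<^sup>+x. (\<integral>\<^sup>+t. g B x t \<partial>lborel) \<partial>R"
  have eq: "TS_levy p \<alpha> R = measure_of UNIV (sets borel) ?m"
    unfolding TS_levy_def g_def by simp
  have "emeasure (TS_levy p \<alpha> R) A = ?m A"
  proof (rule emeasure_measure_of[OF eq])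
    show "sets borel \<subseteq> Pow (UNIV :: 'a set)" by simp
    show "A \<in> sets (TS_levy p \<alpha> R)" using A by (simp add: sets_TS_levy)
    show "positive (sets (TS_levy p \<alpha> R)) ?m"
      by (simp add: positive_def g_def)
    show "countably_additive (sets (TS_levy p \<alpha> R)) ?m"
      unfolding countably_additive_def
    proof (intro allI impI)
      fix F :: "nat \<Rightarrow> 'a set"
      assume F: "range F \<subseteq> sets (TS_levy p \<alpha> R)" and disj: "disjoint_family F"
      have Fm: "F i \<in> sets borel" for i using F by (auto simp: sets_TS_levy)
      have g_sum: "g (\<Union>i. F i) x t = (\<Sum>i. g (F i) x t)" for x t
        unfolding g_def
        by (simp add: suminf_indicator[OF disj, symmetric])
      have "(\<Sum>i. ?m (F i)) = (\<integral>\<^sup>+x. (\<Sum>i. \<integral>\<^sup>+t. g (F i) x t \<partial>lborel) \<partial>R)"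
        by (rule nn_integral_suminf[symmetric]) (rule inner[OF Fm])
      also have "\<dots> = (\<integral>\<^sup>+x. (\<integral>\<^sup>+t. (\<Sum>i. g (F i) x t) \<partial>lborel) \<partial>R)"
        by (intro nn_integral_cong nn_integral_suminf[symmetric] g_meas1 Fm)
      finally show "(\<Sum>i. ?m (F i)) = ?m (\<Union>i. F i)"
        by (simp add: g_sum)
    qed
  qed
  then show ?thesis by (simp add: g_def)
qed

definition is_TS :: "real \<Rightarrow> real \<Rightarrow> 'a::euclidean_space measure \<Rightarrow> 'a \<Rightarrow> 'a measure \<Rightarrow> bool" where
  "is_TS p \<alpha> R b \<mu> \<longleftrightarrow> rosinski_measure \<alpha> R \<and> is_ID0 (TS_levy p \<alpha> R) b \<mu>"

end

theory Submission imports Defs begin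

text \<open>The weight \<open>g x = exp (\<theta> * norm x powr p)\<close> is submultiplicative, because \<open>t \<mapsto> t powr p\<close> is
subadditive for \<open>p \<le> 1\<close>.  For such a weight and an infinitely divisible law \<open>\<mu>\<close> with L\'evy
measure \<open>M\<close>, \<open>g\<close> is integrable against \<open>\<mu>\<close> exactly when it is integrable against the restriction of
\<open>M\<close> to the large jumps \<open>{x. 1 < norm x}\<close> (\<open>infinitely_divisible_moment_iff\<close>).  The rest is
calculus for one explicit measure (\<open>tempered_moment_criterion\<close>).

The moment criterion is proved without constructing the factorisation of \<open>\<mu>\<close> into a small-jump and
a large-jump law.  Cutting off the jumps of size at most \<open>\<epsilon>\<close> leaves compound Poisson laws with
drift; these exist by an explicit formula, and their characteristic functions converge to that of \<open>\<mu>\<close> as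
\<open>\<epsilon> \<rightarrow> 0\<close>.  Each of them is \<open>\<nu>\<^sub>\<epsilon> * P\<close>, where \<open>\<nu>\<^sub>\<epsilon>\<close> carries the jumps of size at most
one and has exponential moments bounded uniformly in \<open>\<epsilon>\<close>, while \<open>P\<close> is the fixed compound Poisson
law of the large jumps.  Submultiplicativity bounds the integral of \<open>g\<close> against \<open>P\<close> by an
exponential series in its integral over the large jumps, and the one-jump term of the same series gives a lower bound.  To
pass to the limit, every law is convolved with a Gaussian: the smoothed densities are integrals of the
characteristic function against a Gaussian measure, so they converge pointwise by dominated
convergence, and a submultiplicative weight changes only by bounded factors under such a smoothing.
Fatou's lemma then gives one implication and dominated convergence on balls the other.

For the tempered stable law, the substitution \<open>u = t * norm x\<close> in the integral defining \<open>M\<close> turns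
the integral of \<open>g\<close> over the large jumps into the integral of \<open>norm x powr \<alpha> * I (\<delta> x)\<close> over \<open>R\<close>, with \<open>\<delta> x = norm x powr (- p) - \<theta>\<close> and
\<open>I \<delta> = \<integral>\<^sub>1\<^sup>\<infinity> exp (- \<delta> u\<^sup>p) u powr (- \<alpha> - 1) du\<close>.  Large values of \<open>\<delta> x\<close> belong to
small \<open>x\<close>, and there the integrand is at most a constant times the square of the norm, which a
Rosinski measure integrates over bounded sets.  So only the behaviour of \<open>I\<close> for \<open>\<delta> < 1\<close> matters,
and it separates the three cases: \<open>I\<close> is infinite for \<open>\<delta> < 0\<close>; as \<open>\<delta>\<close> decreases to \<open>0\<close> it stays
bounded if \<open>\<alpha> > 0\<close>, grows like \<open>\<bar>ln \<delta>\<bar>\<close> if \<open>\<alpha> = 0\<close> and like \<open>\<delta> powr (\<alpha> / p)\<close> if \<open>\<alpha> < 0\<close>.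
At \<open>\<delta> = 0\<close> it is finite only if \<open>\<alpha> > 0\<close>, hence the strict inequality in the first case alone.\<close>

section \<open>Convolutions of laws on a Euclidean space\<close>

lemma integrable_iexp_inner:
  fixes N :: "'a::euclidean_space measure"
  assumes "finite_measure N" "sets N = sets borel"
  shows "integrable N (\<lambda>x. iexp (z \<bullet> x))"
proof -
  interpret finite_measure N by fact
  note assms(2)[measurable_cong]
  show ?thesis by (intro integrable_const_bound[of _ 1]) auto
qed

lemma norm_char_fun_le_1:
  fixes \<mu> :: "'a::euclidean_space measure"
  assumes "prob_space \<mu>"
  shows "cmod (char_fun \<mu> z) \<le> 1"
proof -
  interpret prob_space \<mu> by fact
  have "cmod (char_fun \<mu> z) \<le> (LINT x|\<mu>. cmod (iexp (z \<bullet> x)))"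
    unfolding char_fun_def by (rule integral_norm_bound)
  then show ?thesis by (simp add: prob_space)
qed

definition convolve :: "'a::euclidean_space measure \<Rightarrow> 'a measure \<Rightarrow> 'a measure" where
  "convolve M N = distr (M \<Otimes>\<^sub>M N) borel (\<lambda>(x, y). x + y)"

lemma sets_convolve [simp]: "sets (convolve M N) = sets borel"
  by (simp add: convolve_def)

lemma measurable_add_pair:
  fixes M N :: "'a::euclidean_space measure"
  assumes "sets M = sets borel" "sets N = sets borel"
  shows "(\<lambda>(x, y). x + y) \<in> borel_measurable (M \<Otimes>\<^sub>M N)"
proof -
  note assms[measurable_cong]
  show ?thesis by measurable
qed

lemma prob_space_convolve:
  assumes "prob_space M" "prob_space N" "sets M = sets borel" "sets N = sets borel"
  shows "prob_space (convolve M N)"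
proof -
  interpret M: prob_space M by fact
  interpret N: prob_space N by fact
  interpret pair_prob_space M N ..
  show ?thesis
    unfolding convolve_def by (intro prob_space_distr measurable_add_pair assms)
qed

lemma nn_integral_convolve:
  assumes "prob_space M" "prob_space N" "sets M = sets borel" "sets N = sets borel"
    and f: "f \<in> borel_measurable borel"
  shows "(\<integral>\<^sup>+x. f x \<partial>convolve M N) = (\<integral>\<^sup>+x. \<integral>\<^sup>+y. f (x + y) \<partial>N \<partial>M)"
proof -
  interpret M: prob_space M by fact
  interpret N: prob_space N by fact
  note assms(3,4,5)[measurable_cong, measurable]
  show ?thesis
    unfolding convolve_def
    by (subst nn_integral_distr) (auto simp: N.nn_integral_fst[symmetric] split_beta')
qed

lemma char_fun_convolve:
  assumes "prob_space M" "prob_space N" "sets M = sets borel" "sets N = sets borel"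
  shows "char_fun (convolve M N) z = char_fun M z * char_fun N z"
proof -
  interpret M: prob_space M by fact
  interpret N: prob_space N by fact
  interpret P: pair_prob_space M N ..
  note assms(3,4)[measurable_cong]
  have int: "integrable (M \<Otimes>\<^sub>M N) (\<lambda>p. iexp (z \<bullet> (fst p + snd p)))"
    by (intro P.integrable_const_bound[of _ 1]) auto
  have "char_fun (convolve M N) z = (CLINT p|M \<Otimes>\<^sub>M N. iexp (z \<bullet> (fst p + snd p)))"
    unfolding char_fun_def convolve_def
    by (subst integral_distr) (auto simp: split_beta')
  also have "\<dots> = (CLINT x|M. CLINT y|N. iexp (z \<bullet> (x + y)))"
    using P.integral_fst'[OF int] by simp
  also have "\<dots> = char_fun M z * char_fun N z"
    unfolding char_fun_def by (simp add: inner_add_right algebra_simps exp_add)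
  finally show ?thesis .
qed

lemma char_fun_return_0: "char_fun (return borel 0) z = 1"
  unfolding char_fun_def by (subst integral_return) auto

fun conv_power :: "'a::euclidean_space measure \<Rightarrow> nat \<Rightarrow> 'a measure" where
  "conv_power Q 0 = return borel 0"
| "conv_power Q (Suc k) = convolve Q (conv_power Q k)"

lemma sets_conv_power [simp]: "sets (conv_power Q k) = sets borel"
  by (cases k) auto

lemma prob_space_conv_power:
  assumes "prob_space Q" "sets Q = sets borel"
  shows "prob_space (conv_power Q k)"
  by (induction k) (auto intro!: prob_space_return prob_space_convolve assms)

lemma char_fun_conv_power:
  assumes "prob_space Q" "sets Q = sets borel"
  shows "char_fun (conv_power Q k) z = char_fun Q z ^ k"
  by (induction k) 
    (auto simp: char_fun_return_0 char_fun_convolve prob_space_conv_power assms)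

lemma nn_integral_conv_power_submult_le:
  fixes g :: "'a::euclidean_space \<Rightarrow> ennreal"
  assumes Q: "prob_space Q" "sets Q = sets borel"
    and g [measurable]: "g \<in> borel_measurable borel" and "g 0 \<le> 1"
    and sub: "\<And>x y. g (x + y) \<le> g x * g y"
  shows "(\<integral>\<^sup>+x. g x \<partial>conv_power Q k) \<le> (\<integral>\<^sup>+x. g x \<partial>Q) ^ k"
proof (induction k)
  case 0
  then show ?case using assms by (simp add: nn_integral_return)
next
  case (Suc k)
  note Q(2)[measurable_cong]
  have "(\<integral>\<^sup>+x. g x \<partial>conv_power Q (Suc k)) = (\<integral>\<^sup>+x. \<integral>\<^sup>+y. g (x + y) \<partial>conv_power Q k \<partial>Q)"
    by (simp add: nn_integral_convolve Q prob_space_conv_power)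
  also have "\<dots> \<le> (\<integral>\<^sup>+x. \<integral>\<^sup>+y. g x * g y \<partial>conv_power Q k \<partial>Q)"
    by (intro nn_integral_mono sub)
  also have "\<dots> = (\<integral>\<^sup>+x. g x \<partial>Q) * (\<integral>\<^sup>+y. g y \<partial>conv_power Q k)"
    by (simp add: nn_integral_cmult nn_integral_multc measurable_cong_sets[OF sets_conv_power refl])
  also have "\<dots> \<le> (\<integral>\<^sup>+x. g x \<partial>Q) ^ Suc k"
    using mult_left_mono[OF Suc, of "\<integral>\<^sup>+x. g x \<partial>Q"] by simp
  finally show ?case .
qed

section \<open>Compound Poisson laws\<close>

definition compound_poisson :: "real \<Rightarrow> 'a::euclidean_space measure \<Rightarrow> 'a measure" where
  "compound_poisson c Q = measure_pmf (poisson_pmf c) \<bind> conv_power Q"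

lemma conv_power_kernel:
  assumes "prob_space Q" "sets Q = sets borel"
  shows "conv_power Q \<in> measurable (measure_pmf r) (subprob_algebra borel)"
  by (auto simp: space_subprob_algebra prob_space_conv_power assms
      intro!: prob_space_imp_subprob_space)

lemma nn_integral_poisson_pmf:
  assumes "0 < c"
  shows "(\<integral>\<^sup>+k. f k \<partial>measure_pmf (poisson_pmf c)) =
    (\<Sum>k. ennreal (c ^ k / fact k * exp (- c)) * f k)"
  by (simp add: nn_integral_measure_pmf nn_integral_count_space_nat assms)

text \<open>The probability generating function of a Poisson variable, at a complex argument.  With
the characteristic function of a jump as argument it gives that of a random sum of jumps.\<close>

lemma integral_poisson_pmf_power:
  assumes "0 < c" and a: "cmod a \<le> 1"
  shows "(CLINT k|measure_pmf (poisson_pmf c). a ^ k) = exp (of_real c * (a - 1))"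
proof -
  have e: "(\<lambda>k. (of_real c * a) ^ k /\<^sub>R fact k) sums exp (of_real c * a)"
    by (rule exp_converges)
  have sm: "summable (\<lambda>k. norm ((of_real c * a) ^ k /\<^sub>R fact k))"
    by (rule summable_norm_exp)
  have eq: "(c ^ k / fact k * exp (- c)) *\<^sub>R a ^ k = exp (- of_real c) * ((of_real c * a) ^ k /\<^sub>R fact k)" for k
    by (simp add: scaleR_conv_of_real power_mult_distrib field_simps exp_of_real flip: of_real_minus)
  have int: "integrable (count_space UNIV) (\<lambda>k. (c ^ k / fact k * exp (- c)) *\<^sub>R a ^ k)"
    unfolding integrable_count_space_nat_iff eq norm_mult
    by (intro summable_mult sm)
  have "(CLINT k|measure_pmf (poisson_pmf c). a ^ k) =
      (CLINT k|count_space UNIV. (c ^ k / fact k * exp (- c)) *\<^sub>R a ^ k)"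
    unfolding measure_pmf_eq_density
    by (subst integral_density) (use assms in auto)
  also have "\<dots> = (\<Sum>k. (c ^ k / fact k * exp (- c)) *\<^sub>R a ^ k)"
    by (rule integral_count_space_nat[OF int])
  also have "\<dots> = exp (- of_real c) * exp (of_real c * a)"
    unfolding eq using sums_unique[OF sums_mult[OF e]] by simp
  finally show ?thesis by (simp add: exp_add[symmetric] algebra_simps)
qed

context
  fixes c :: real and Q :: "'a::euclidean_space measure"
  assumes c: "0 < c" and Q: "prob_space Q" "sets Q = sets borel"
begin

lemma sets_compound_poisson: "sets (compound_poisson c Q) = sets borel"
  unfolding compound_poisson_def by (rule sets_bind) auto

lemma prob_space_compound_poisson: "prob_space (compound_poisson c Q)"
  unfolding compound_poisson_def
  by (rule prob_space.prob_space_bind[OF prob_space_measure_pmf _ conv_power_kernel[OF Q]])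
    (simp add: prob_space_conv_power Q)

lemma nn_integral_compound_poisson:
  assumes "f \<in> borel_measurable borel"
  shows "(\<integral>\<^sup>+x. f x \<partial>compound_poisson c Q) =
    (\<Sum>k. ennreal (c ^ k / fact k * exp (- c)) * (\<integral>\<^sup>+x. f x \<partial>conv_power Q k))"
  unfolding compound_poisson_def nn_integral_bind[OF assms conv_power_kernel[OF Q]]
  by (rule nn_integral_poisson_pmf[OF c])

lemma char_fun_compound_poisson:
  "char_fun (compound_poisson c Q) z = exp (of_real c * (char_fun Q z - 1))"
proof -
  interpret Q: prob_space Q by fact
  interpret P: prob_space "compound_poisson c Q" by (rule prob_space_compound_poisson)
  let ?p = "measure_pmf (poisson_pmf c)"
  note sets_compound_poisson[measurable_cong] Q(2)[measurable_cong]
  have bd: "(LINT x|compound_poisson c Q. f x) = (LINT k|?p. LINT x|conv_power Q k. f x)"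
    if "f \<in> borel_measurable borel" "\<And>x. \<bar>f x\<bar> \<le> 1" for f :: "'a \<Rightarrow> real"
    unfolding compound_poisson_def
    by (rule integral_bind[where B=1 and B'=1, OF that(1) _ conv_power_kernel[OF Q]])
      (auto simp: that measure_pmf.finite_measure_axioms
         prob_space.emeasure_space_1[OF prob_space_conv_power[OF Q]] simp del: sets_conv_power)
  have int: "integrable ?p (\<lambda>k. char_fun Q z ^ k)"
    by (intro measure_pmf.integrable_const_bound[of _ 1])
      (auto simp: norm_power power_le_one norm_char_fun_le_1[OF Q(1)])
  have ik: "integrable (conv_power Q k) (\<lambda>x. iexp (z \<bullet> x))" for k
    by (intro integrable_iexp_inner prob_space.finite_measure prob_space_conv_power Q) simp
  have iP: "integrable (compound_poisson c Q) (\<lambda>x. iexp (z \<bullet> x))"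
    by (intro integrable_iexp_inner P.finite_measure_axioms sets_compound_poisson)
  have [simp]: "Re (iexp t) = cos t" "Im (iexp t) = sin t" for t
    by (simp_all add: Re_exp Im_exp)
  have Re_k: "(LINT x|conv_power Q k. cos (z \<bullet> x)) = Re (char_fun Q z ^ k)" for k
    unfolding char_fun_conv_power[OF Q, symmetric] unfolding char_fun_def
    by (subst integral_Re[OF ik, symmetric]) simp
  have Im_k: "(LINT x|conv_power Q k. sin (z \<bullet> x)) = Im (char_fun Q z ^ k)" for k
    unfolding char_fun_conv_power[OF Q, symmetric] unfolding char_fun_def
    by (subst integral_Im[OF ik, symmetric]) simp
  have "Re (char_fun (compound_poisson c Q) z) = (LINT x|compound_poisson c Q. cos (z \<bullet> x))"
    unfolding char_fun_def by (subst integral_Re[OF iP, symmetric]) simp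
  also have "\<dots> = (LINT k|?p. LINT x|conv_power Q k. cos (z \<bullet> x))"
    by (rule bd) auto
  also have "\<dots> = (LINT k|?p. Re (char_fun Q z ^ k))"
    by (simp only: Re_k)
  also have "\<dots> = Re (CLINT k|?p. char_fun Q z ^ k)"
    by (rule integral_Re[OF int])
  finally have re: "Re (char_fun (compound_poisson c Q) z) = Re (CLINT k|?p. char_fun Q z ^ k)" .
  have "Im (char_fun (compound_poisson c Q) z) = (LINT x|compound_poisson c Q. sin (z \<bullet> x))"
    unfolding char_fun_def by (subst integral_Im[OF iP, symmetric]) simp
  also have "\<dots> = (LINT k|?p. LINT x|conv_power Q k. sin (z \<bullet> x))"
    by (rule bd) auto
  also have "\<dots> = (LINT k|?p. Im (char_fun Q z ^ k))"
    by (simp only: Im_k)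
  also have "\<dots> = Im (CLINT k|?p. char_fun Q z ^ k)"
    by (rule integral_Im[OF int])
  finally have "char_fun (compound_poisson c Q) z = (CLINT k|?p. char_fun Q z ^ k)"
    using re by (intro complex_eqI)
  then show ?thesis
    by (simp add: integral_poisson_pmf_power[OF c norm_char_fun_le_1[OF Q(1)]])
qed

text \<open>Under \<open>k\<close> independent jumps the weight integrates to at most \<open>m ^ k\<close>, and averaging this
over the Poisson number of jumps sums to an exponential.\<close>

lemma nn_integral_compound_poisson_submult_le:
  fixes g :: "'a::euclidean_space \<Rightarrow> ennreal"
  assumes g [measurable]: "g \<in> borel_measurable borel" and "g 0 \<le> 1"
    and sub: "\<And>x y. g (x + y) \<le> g x * g y"
    and fin: "(\<integral>\<^sup>+x. g x \<partial>Q) = ennreal m" and m: "0 \<le> m"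
  shows "(\<integral>\<^sup>+x. g x \<partial>compound_poisson c Q) \<le> ennreal (exp (c * (m - 1)))"
proof -
  have s: "(\<lambda>k. (c * m) ^ k /\<^sub>R fact k) sums exp (c * m)"
    by (rule exp_converges)
  have "(\<integral>\<^sup>+x. g x \<partial>compound_poisson c Q) =
    (\<Sum>k. ennreal (c ^ k / fact k * exp (- c)) * (\<integral>\<^sup>+x. g x \<partial>conv_power Q k))"
    by (rule nn_integral_compound_poisson) fact
  also have "\<dots> \<le> (\<Sum>k. ennreal (exp (- c) * ((c * m) ^ k /\<^sub>R fact k)))"
  proof (rule suminf_le)
    fix k
    have "ennreal (c ^ k / fact k * exp (- c)) * (\<integral>\<^sup>+x. g x \<partial>conv_power Q k)
        \<le> ennreal (c ^ k / fact k * exp (- c)) * ennreal (m ^ k)"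
      using nn_integral_conv_power_submult_le[OF Q g assms(2) sub, of k] m
      by (intro mult_left_mono) (auto simp: fin ennreal_power)
    also have "\<dots> = ennreal (exp (- c) * ((c * m) ^ k /\<^sub>R fact k))"
      using c m by (simp add: ennreal_mult[symmetric] power_mult_distrib field_simps)
    finally show "ennreal (c ^ k / fact k * exp (- c)) * (\<integral>\<^sup>+x. g x \<partial>conv_power Q k)
      \<le> ennreal (exp (- c) * ((c * m) ^ k /\<^sub>R fact k))" .
  qed auto
  also have "\<dots> = ennreal (exp (- c) * exp (c * m))"
    using sums_mult[OF s, of "exp (- c)"] c m
    by (intro suminf_ennreal_eq) auto
  finally show ?thesis
    by (simp add: exp_add[symmetric] algebra_simps)
qed

text \<open>The right-hand side is a series over the number of jumps; the left-hand side is its term for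
exactly one jump.\<close>

lemma nn_integral_compound_poisson_ge:
  fixes f :: "'a::euclidean_space \<Rightarrow> ennreal"
  assumes f [measurable]: "f \<in> borel_measurable borel"
  shows "ennreal (c * exp (- c)) * (\<integral>\<^sup>+x. f x \<partial>Q) \<le> (\<integral>\<^sup>+x. f x \<partial>compound_poisson c Q)"
proof -
  let ?t = "\<lambda>k. ennreal (c ^ k / fact k * exp (- c)) * (\<integral>\<^sup>+x. f x \<partial>conv_power Q k)"
  note Q(2)[measurable_cong]
  have "(\<integral>\<^sup>+x. f x \<partial>conv_power Q 1) = (\<integral>\<^sup>+x. f x \<partial>Q)"
    by (simp add: nn_integral_convolve Q prob_space_return nn_integral_return)
  then have "ennreal (c * exp (- c)) * (\<integral>\<^sup>+x. f x \<partial>Q) = sum ?t {1}"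
    by simp
  also have "\<dots> \<le> (\<Sum>k. ?t k)"
    by (rule sum_le_suminf) auto
  finally show ?thesis by (simp add: nn_integral_compound_poisson)
qed

end

text \<open>The compound Poisson law indexed by its finite jump measure \<open>N\<close> instead of the pair of
intensity and jump distribution.  In this form the exponent of the characteristic function and both
integral bounds are additive in \<open>N\<close>, which suits the L\'evy-Khintchine exponent.\<close>

lemma compound_poisson_exists:
  fixes N :: "'a::euclidean_space measure"
  assumes N: "finite_measure N" "sets N = sets borel"
  obtains P where "prob_space P" "sets P = sets borel"
    "\<And>z. char_fun P z = exp (CLINT x|N. iexp (z \<bullet> x) - 1)"
    "\<And>g. g \<in> borel_measurable borel \<Longrightarrow> (\<And>x. 0 \<le> g x) \<Longrightarrow> g 0 \<le> 1 \<Longrightarrow>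
       (\<And>x y. g (x + y) \<le> g x * g y) \<Longrightarrow> integrable N g \<Longrightarrow>
       (\<integral>\<^sup>+x. ennreal (g x) \<partial>P) \<le> ennreal (exp (LINT x|N. g x - 1))"
    "\<And>f. f \<in> borel_measurable borel \<Longrightarrow>
       ennreal (exp (- measure N UNIV)) * (\<integral>\<^sup>+x. f x \<partial>N) \<le> (\<integral>\<^sup>+x. f x \<partial>P)"
proof -
  interpret N: finite_measure N by fact
  have spN: "space N = UNIV" using sets_eq_imp_space_eq[OF N(2)] by simp
  define c where "c = measure N UNIV"
  have cN: "emeasure N UNIV = ennreal c" unfolding c_def by (simp add: N.emeasure_eq_measure)
  note N(2)[measurable_cong]
  \<comment> \<open>The Poisson distribution is defined for a positive intensity only; for the null measure the
     law is the point mass at the origin.\<close>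
  show ?thesis
  proof (cases "c = 0")
    case True
    have null: "AE x in N. False"
      using True cN by (intro AE_I'[of UNIV]) (auto simp: null_sets_def N(2) spN)
    have [simp]: "integral\<^sup>L N f = 0" for f :: "'a \<Rightarrow> 'b::{banach, second_countable_topology}"
      by (rule integral_eq_zero_AE) (use null in \<open>auto elim: eventually_mono\<close>)
    have [simp]: "(\<integral>\<^sup>+x. f x \<partial>N) = 0" for f
    proof -
      have "(\<integral>\<^sup>+x. f x \<partial>N) = (\<integral>\<^sup>+x. 0 \<partial>N)"
        by (rule nn_integral_cong_AE) (use null in \<open>auto elim: eventually_mono\<close>)
      then show ?thesis by simp
    qed
    show ?thesis
      by (rule that[of "return borel 0"])
        (auto simp: prob_space_return char_fun_return_0 nn_integral_return)
  next
    case False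
    then have c: "0 < c" using measure_nonneg[of N UNIV] unfolding c_def by linarith
    define Q where "Q = density N (\<lambda>_. ennreal (1 / c))"
    have Q: "prob_space Q" "sets Q = sets borel"
      unfolding Q_def using c N(2)
      by (auto intro!: prob_spaceI simp: emeasure_density spN cN nn_integral_cmult[symmetric] 
         ennreal_mult[symmetric])
    have nnQ: "(\<integral>\<^sup>+x. f x \<partial>Q) = ennreal (1 / c) * (\<integral>\<^sup>+x. f x \<partial>N)" if "f \<in> borel_measurable borel" for f
      unfolding Q_def using that by (simp add: nn_integral_density nn_integral_cmult)
    show ?thesis
    proof (rule that[of "compound_poisson c Q"])
      show "prob_space (compound_poisson c Q)" by (rule prob_space_compound_poisson[OF c Q])
      show "sets (compound_poisson c Q) = sets borel" by (rule sets_compound_poisson[OF c Q])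
      have "of_real c * (char_fun Q z - 1) = (CLINT x|N. iexp (z \<bullet> x) - 1)" for z
      proof -
        have "char_fun Q z = (CLINT x|N. (1 / c) *\<^sub>R iexp (z \<bullet> x))"
          unfolding Q_def char_fun_def using c by (subst integral_density) auto
        then have "of_real c * (char_fun Q z - 1) = (CLINT x|N. iexp (z \<bullet> x)) - of_real c"
          using c by (simp add: scaleR_conv_of_real algebra_simps)
        also have "\<dots> = (CLINT x|N. iexp (z \<bullet> x) - 1)"
          using N by (subst Bochner_Integration.integral_diff) (auto simp: integrable_iexp_inner c_def spN scaleR_conv_of_real)
        finally show ?thesis .
      qed
      then show "char_fun (compound_poisson c Q) z = exp (CLINT x|N. iexp (z \<bullet> x) - 1)" for z
        by (simp add: char_fun_compound_poisson[OF c Q])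
      show "ennreal (exp (- measure N UNIV)) * (\<integral>\<^sup>+x. f x \<partial>N) \<le> (\<integral>\<^sup>+x. f x \<partial>compound_poisson c Q)"
        if f: "f \<in> borel_measurable borel" for f
      proof -
        have "ennreal (exp (- c)) * (\<integral>\<^sup>+x. f x \<partial>N) = ennreal (c * exp (- c)) * (\<integral>\<^sup>+x. f x \<partial>Q)"
          using c by (simp add: nnQ[OF f] mult.assoc[symmetric] ennreal_mult[symmetric])
        also have "\<dots> \<le> (\<integral>\<^sup>+x. f x \<partial>compound_poisson c Q)"
          by (rule nn_integral_compound_poisson_ge[OF c Q f])
        finally show ?thesis by (simp add: c_def)
      qed
      show "(\<integral>\<^sup>+x. ennreal (g x) \<partial>compound_poisson c Q) \<le> ennreal (exp (LINT x|N. g x - 1))"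
        if g [measurable]: "g \<in> borel_measurable borel" and g0: "\<And>x. 0 \<le> g x" and g1: "g 0 \<le> 1"
          and sub: "\<And>x y. g (x + y) \<le> g x * g y" and int: "integrable N g" for g
      proof -
        have "(\<integral>\<^sup>+x. ennreal (g x) \<partial>Q) = ennreal (1 / c) * ennreal (LINT x|N. g x)"
          by (simp add: nnQ nn_integral_eq_integral[OF int] g0)
        also have "\<dots> = ennreal ((LINT x|N. g x) / c)"
          using c by (simp add: ennreal_mult[symmetric] g0 integral_nonneg)
        finally have "(\<integral>\<^sup>+x. ennreal (g x) \<partial>compound_poisson c Q)
            \<le> ennreal (exp (c * ((LINT x|N. g x) / c - 1)))"
          using c by (intro nn_integral_compound_poisson_submult_le[OF c Q])
            (auto simp: g0 g1 sub ennreal_mult[symmetric] integral_nonneg)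
        also have "c * ((LINT x|N. g x) / c - 1) = (LINT x|N. g x) - c"
          using c by (simp add: field_simps)
        also have "\<dots> = (LINT x|N. g x - 1)"
          by (subst Bochner_Integration.integral_diff) (auto simp: int c_def spN)
        finally show ?thesis .
      qed
    qed
  qed
qed

section \<open>Gaussian smoothing\<close>

definition gaussian :: "'a::euclidean_space measure" where
  "gaussian = distr (\<Pi>\<^sub>M i\<in>Basis. std_normal_distribution) borel (\<lambda>f. \<Sum>i\<in>Basis. f i *\<^sub>R i)"

lemma sets_gaussian [simp, measurable_cong]: "sets gaussian = sets borel"
  by (simp add: gaussian_def)

lemma sum_scaleR_Basis_measurable:
  "(\<lambda>f. \<Sum>i\<in>Basis. f i *\<^sub>R i) \<in> borel_measurable (\<Pi>\<^sub>M i\<in>(Basis :: 'a::euclidean_space set). std_normal_distribution)"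
proof (intro borel_measurable_sum borel_measurable_scaleR)
  fix i :: 'a assume "i \<in> Basis"
  then have "(\<lambda>f. f i) \<in> measurable (\<Pi>\<^sub>M i\<in>(Basis :: 'a set). std_normal_distribution) std_normal_distribution"
    by (rule measurable_component_singleton)
  then show "(\<lambda>f. f i) \<in> borel_measurable (\<Pi>\<^sub>M i\<in>(Basis :: 'a set). std_normal_distribution)"
    by (simp add: measurable_cong_sets[OF refl, of std_normal_distribution borel])
qed auto

lemma prob_space_gaussian: "prob_space (gaussian :: 'a::euclidean_space measure)"
proof -
  interpret S: prob_space std_normal_distribution
    by (rule prob_space_normal_density) simp
  interpret product_prob_space "\<lambda>_::'a. std_normal_distribution" "Basis :: 'a set" ..
  show ?thesis
    unfolding gaussian_def
    by (rule P.prob_space_distr) (rule sum_scaleR_Basis_measurable)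
qed

lemma char_fun_gaussian:
  "char_fun gaussian z = of_real (exp (- (norm z)\<^sup>2 / 2))" for z :: "'a::euclidean_space"
proof -
  interpret S: prob_space std_normal_distribution
    by (rule prob_space_normal_density) simp
  interpret product_prob_space "\<lambda>_::'a. std_normal_distribution" "Basis :: 'a set" ..
  have int: "integrable std_normal_distribution (\<lambda>t. iexp ((z \<bullet> i) * t))" for i
    by (intro S.integrable_const_bound[of _ 1]) auto
  have "char_fun gaussian z =
      (CLINT f|(\<Pi>\<^sub>M i\<in>Basis. std_normal_distribution). iexp (z \<bullet> (\<Sum>i\<in>Basis. f i *\<^sub>R i)))"
    unfolding char_fun_def gaussian_def
    by (subst integral_distr[OF sum_scaleR_Basis_measurable]) auto
  also have "\<dots> = (CLINT f|(\<Pi>\<^sub>M i\<in>Basis. std_normal_distribution). \<Prod>i\<in>Basis. iexp ((z \<bullet> i) * f i))"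
    by (simp add: inner_sum_right exp_sum sum_distrib_left mult.commute)
  also have "\<dots> = (\<Prod>i\<in>Basis. CLINT t|std_normal_distribution. iexp ((z \<bullet> i) * t))"
    by (rule product_integral_prod[OF finite_Basis int])
  also have "\<dots> = (\<Prod>i\<in>Basis. of_real (exp (- (z \<bullet> i)\<^sup>2 / 2)))"
    using fun_cong[OF char_std_normal_distribution] by (simp add: char_def)
  also have "\<dots> = of_real (exp (\<Sum>i\<in>Basis. - (z \<bullet> i)\<^sup>2 / 2))"
    by (simp add: exp_sum)
  also have "(\<Sum>i\<in>Basis. - (z \<bullet> i)\<^sup>2 / 2) = - (norm z)\<^sup>2 / 2"
    unfolding power2_norm_eq_inner euclidean_inner[of z z]
    by (simp add: sum_negf sum_divide_distrib power2_eq_square)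
  finally show ?thesis .
qed

definition gauss_kernel :: "'a::euclidean_space \<Rightarrow> real" where
  "gauss_kernel x = exp (- (norm x)\<^sup>2 / 2)"

lemma gauss_kernel_measurable [measurable]: "gauss_kernel \<in> borel_measurable borel"
  unfolding gauss_kernel_def by measurable

lemma gauss_kernel_pos: "0 < gauss_kernel x"
  and gauss_kernel_le_1: "gauss_kernel x \<le> 1"
  and gauss_kernel_minus [simp]: "gauss_kernel (- x) = gauss_kernel x"
  by (simp_all add: gauss_kernel_def)

text \<open>Up to the constant \<open>(2 * pi) powr (- d / 2)\<close> in dimension \<open>d\<close>, this is the Lebesgue density of
the convolution of \<open>\<mu>\<close> with the standard Gaussian law.\<close>

definition gauss_smooth :: "'a::euclidean_space measure \<Rightarrow> 'a \<Rightarrow> real" where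
  "gauss_smooth \<mu> y = (LINT x|\<mu>. gauss_kernel (x - y))"

text \<open>The Gaussian kernel is itself a characteristic function, so by Fubini the smoothed density
is an average of the characteristic function of \<open>\<mu>\<close>.\<close>

lemma gauss_smooth_char_fun:
  fixes \<mu> :: "'a::euclidean_space measure"
  assumes "prob_space \<mu>" "sets \<mu> = sets borel"
  shows "of_real (gauss_smooth \<mu> y) = (CLINT w|gaussian. iexp (- (y \<bullet> w)) * char_fun \<mu> w)"
proof -
  interpret M: prob_space \<mu> by fact
  interpret G: prob_space "gaussian :: 'a measure" by (rule prob_space_gaussian)
  interpret P: pair_prob_space \<mu> "gaussian :: 'a measure" ..
  note assms(2)[measurable_cong]
  have int: "integrable (\<mu> \<Otimes>\<^sub>M gaussian) (\<lambda>(x, w). iexp ((x - y) \<bullet> w))"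
    by (intro P.integrable_const_bound[of _ 1]) auto
  have "of_real (gauss_smooth \<mu> y) = (CLINT x|\<mu>. char_fun gaussian (x - y))"
    unfolding gauss_smooth_def char_fun_gaussian gauss_kernel_def by simp
  also have "\<dots> = (CLINT w|gaussian. CLINT x|\<mu>. iexp ((x - y) \<bullet> w))"
    unfolding char_fun_def using P.Fubini_integral[OF int] by simp
  also have "\<dots> = (CLINT w|gaussian. iexp (- (y \<bullet> w)) * char_fun \<mu> w)"
    unfolding char_fun_def
    by (simp add: inner_diff_left algebra_simps exp_add[symmetric] inner_commute
       flip: integral_mult_right_zero)
  finally show ?thesis .
qed

lemma char_fun_measurable:
  fixes \<mu> :: "'a::euclidean_space measure"
  assumes "prob_space \<mu>" "sets \<mu> = sets borel"
  shows "char_fun \<mu> \<in> borel_measurable borel"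
proof -
  interpret M: prob_space \<mu> by fact
  note assms(2)[measurable_cong]
  show ?thesis
    unfolding char_fun_def by (rule M.borel_measurable_lebesgue_integral) measurable
qed

text \<open>This replaces L\'evy's continuity theorem: characteristic functions are bounded by one, so
dominated convergence applies to the averages representing the smoothed densities.\<close>

lemma gauss_smooth_tendsto:
  fixes \<mu> :: "'a::euclidean_space measure" and \<nu> :: "nat \<Rightarrow> 'a measure"
  assumes \<mu>: "prob_space \<mu>" "sets \<mu> = sets borel"
    and \<nu>: "\<And>n. prob_space (\<nu> n)" "\<And>n. sets (\<nu> n) = sets borel"
    and lim: "\<And>z. (\<lambda>n. char_fun (\<nu> n) z) \<longlonglongrightarrow> char_fun \<mu> z"
  shows "(\<lambda>n. gauss_smooth (\<nu> n) y) \<longlonglongrightarrow> gauss_smooth \<mu> y"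
proof -
  interpret G: prob_space "gaussian :: 'a measure" by (rule prob_space_gaussian)
  note char_fun_measurable[OF \<mu>, measurable] char_fun_measurable[OF \<nu>, measurable]
  have "(\<lambda>n. CLINT w|gaussian. iexp (- (y \<bullet> w)) * char_fun (\<nu> n) w)
     \<longlonglongrightarrow> (CLINT w|gaussian. iexp (- (y \<bullet> w)) * char_fun \<mu> w)"
    by (rule integral_dominated_convergence[where w = "\<lambda>_. 1"])
      (auto intro!: tendsto_mult lim simp: norm_mult norm_char_fun_le_1 \<nu>)
  then have "(\<lambda>n. complex_of_real (gauss_smooth (\<nu> n) y)) \<longlonglongrightarrow> of_real (gauss_smooth \<mu> y)"
    by (simp add: gauss_smooth_char_fun \<mu> \<nu>)
  then show ?thesis by (simp add: tendsto_of_real_iff)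
qed

lemma gauss_smooth_nn_integral:
  fixes \<mu> :: "'a::euclidean_space measure"
  assumes "prob_space \<mu>" "sets \<mu> = sets borel"
  shows "ennreal (gauss_smooth \<mu> y) = (\<integral>\<^sup>+x. ennreal (gauss_kernel (x - y)) \<partial>\<mu>)"
proof -
  interpret M: prob_space \<mu> by fact
  note assms(2)[measurable_cong]
  have "integrable \<mu> (\<lambda>x. gauss_kernel (x - y))"
    by (rule M.integrable_const_bound[of _ 1]) 
      (auto simp: gauss_kernel_pos gauss_kernel_le_1 less_imp_le)
  then show ?thesis
    unfolding gauss_smooth_def
    by (subst nn_integral_eq_integral) (auto simp: gauss_kernel_pos less_imp_le)
qed

lemma gauss_smooth_bounds:
  assumes "prob_space \<mu>" "sets \<mu> = sets borel"
  shows "0 \<le> gauss_smooth \<mu> y" "gauss_smooth \<mu> y \<le> 1"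
proof -
  interpret M: prob_space \<mu> by fact
  show "0 \<le> gauss_smooth \<mu> y"
    unfolding gauss_smooth_def by (intro Bochner_Integration.integral_nonneg) (simp add: gauss_kernel_pos less_imp_le)
  have "(\<integral>\<^sup>+x. ennreal (gauss_kernel (x - y)) \<partial>\<mu>) \<le> (\<integral>\<^sup>+x. 1 \<partial>\<mu>)"
    by (intro nn_integral_mono) (simp add: gauss_kernel_le_1)
  then show "gauss_smooth \<mu> y \<le> 1"
    by (simp add: gauss_smooth_nn_integral[OF assms, symmetric] M.emeasure_space_1)
qed

lemma gauss_smooth_measurable:
  fixes \<mu> :: "'a::euclidean_space measure"
  assumes "prob_space \<mu>" "sets \<mu> = sets borel"
  shows "gauss_smooth \<mu> \<in> borel_measurable borel"
proof -
  interpret M: prob_space \<mu> by fact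
  note assms(2)[measurable_cong]
  show ?thesis
    unfolding gauss_smooth_def by (rule M.borel_measurable_lebesgue_integral) measurable
qed

lemma nn_integral_gauss_smooth:
  fixes \<mu> :: "'a::euclidean_space measure"
  assumes \<mu>: "prob_space \<mu>" "sets \<mu> = sets borel" and f [measurable]: "f \<in> borel_measurable borel"
  shows "(\<integral>\<^sup>+y. f y * ennreal (gauss_smooth \<mu> y) \<partial>lborel) =
    (\<integral>\<^sup>+x. (\<integral>\<^sup>+w. f (x + w) * ennreal (gauss_kernel w) \<partial>lborel) \<partial>\<mu>)"
proof -
  interpret M: prob_space \<mu> by fact
  interpret P: pair_sigma_finite \<mu> lborel ..
  note \<mu>(2)[measurable_cong]
  have "(\<integral>\<^sup>+y. f y * ennreal (gauss_smooth \<mu> y) \<partial>lborel)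
     = (\<integral>\<^sup>+y. (\<integral>\<^sup>+x. f y * ennreal (gauss_kernel (x - y)) \<partial>\<mu>) \<partial>lborel)"
    by (simp add: gauss_smooth_nn_integral[OF \<mu>] nn_integral_cmult)
  also have "\<dots> = (\<integral>\<^sup>+x. (\<integral>\<^sup>+y. f y * ennreal (gauss_kernel (x - y)) \<partial>lborel) \<partial>\<mu>)"
    by (rule P.Fubini') measurable
  also have "\<dots> = (\<integral>\<^sup>+x. (\<integral>\<^sup>+w. f (x + w) * ennreal (gauss_kernel w) \<partial>lborel) \<partial>\<mu>)"
  proof (rule nn_integral_cong)
    fix x
    have "(\<integral>\<^sup>+y. f y * ennreal (gauss_kernel (x - y)) \<partial>lborel) =
      (\<integral>\<^sup>+y. f y * ennreal (gauss_kernel (x - y)) \<partial>distr lborel borel ((+) x))"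
      by (simp add: lborel_distr_plus)
    also have "\<dots> = (\<integral>\<^sup>+w. f (x + w) * ennreal (gauss_kernel w) \<partial>lborel)"
      by (subst nn_integral_distr) auto
    finally show "(\<integral>\<^sup>+y. f y * ennreal (gauss_kernel (x - y)) \<partial>lborel) =
      (\<integral>\<^sup>+w. f (x + w) * ennreal (gauss_kernel w) \<partial>lborel)" .
  qed
  finally show ?thesis .
qed

lemma nn_integral_exp_minus_norm_square_finite:
  "(\<integral>\<^sup>+x. ennreal (exp (- (norm x)\<^sup>2 / 4)) \<partial>(lborel :: 'a::euclidean_space measure)) < \<infinity>"
proof -
  have e: "exp (- (norm x)\<^sup>2 / 4) = (\<Prod>b\<in>Basis. exp (- (x \<bullet> b)\<^sup>2 / 4))" for x :: 'a
    unfolding power2_norm_eq_inner euclidean_inner[of x x]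
    by (simp add: exp_sum[symmetric] sum_negf sum_divide_distrib power2_eq_square)
  have "(\<integral>\<^sup>+t. ennreal (exp (- t\<^sup>2 / 4)) \<partial>lborel) = 
      (\<integral>\<^sup>+t. ennreal (sqrt (4 * pi)) * ennreal (normal_density 0 (sqrt 2) t) \<partial>lborel)"
    by (intro nn_integral_cong) (simp add: normal_density_def ennreal_mult[symmetric])
  also have "\<dots> = ennreal (sqrt (4 * pi)) * (\<integral>\<^sup>+t. ennreal (normal_density 0 (sqrt 2) t) \<partial>lborel)"
    by (rule nn_integral_cmult) measurable
  also have "(\<integral>\<^sup>+t. ennreal (normal_density 0 (sqrt 2) t) \<partial>lborel) = 1"
    by (subst nn_integral_eq_integral) auto
  finally have f: "(\<integral>\<^sup>+t. ennreal (exp (- t\<^sup>2 / 4)) \<partial>lborel) < \<infinity>"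
    by (simp add: ennreal_mult_less_top)
  have "(\<integral>\<^sup>+x. ennreal (exp (- (norm x)\<^sup>2 / 4)) \<partial>(lborel :: 'a measure)) =
     (\<integral>\<^sup>+x. (\<Prod>b\<in>Basis. ennreal (exp (- (x \<bullet> b)\<^sup>2 / 4))) \<partial>(lborel :: 'a measure))"
    unfolding e by (simp add: prod_ennreal)
  also have "\<dots> = (\<Prod>b\<in>(Basis :: 'a set). \<integral>\<^sup>+t. ennreal (exp (- t\<^sup>2 / 4)) \<partial>lborel)"
    by (rule nn_integral_lborel_prod) auto
  also have "\<dots> < \<infinity>"
    using f by (simp add: ennreal_prod_eq_top less_top[symmetric] power_eq_top_ennreal)
  finally show ?thesis .
qed

section \<open>Submultiplicative weights and limits of laws\<close>

lemma cball_measurable [measurable]: "cball (c::'a::euclidean_space) r \<in> sets borel"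
  by (rule borel_closed) simp

text \<open>A locally bounded submultiplicative function grows at most exponentially; \<open>C\<close> and \<open>\<kappa>\<close> name
one such bound.  The rate \<open>\<kappa>\<close> is taken positive so that a
bound on the moment of \<open>exp (\<kappa> * norm x)\<close> also yields tightness.\<close>

locale submultiplicative_weight =
  fixes g :: "'a::euclidean_space \<Rightarrow> real" and C \<kappa> :: real
  assumes meas [measurable]: "g \<in> borel_measurable borel"
    and nonneg: "0 \<le> g x"
    and at_0: "g 0 = 1"
    and sym: "g (- x) = g x"
    and submult: "g (x + y) \<le> g x * g y"
    and rate_pos: "0 < \<kappa>"
    and growth: "g x \<le> C * exp (\<kappa> * norm x)"
begin

lemma ge_1: "1 \<le> g x"
proof (rule ccontr)
  assume "\<not> 1 \<le> g x"
  then have "g x * g x < 1" using nonneg[of x] 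
    by (meson le_less_linear less_le_not_le mult_le_one order.strict_trans1 mult_left_le not_le)
  with submult[of x "- x"] show False by (simp add: at_0 sym)
qed

lemma const_pos: "0 < C"
  using growth[of 0] by (simp add: at_0)

lemma submult_sub: "g x \<le> g (x + y) * g y"
  using submult[of "x + y" "- y"] by (simp add: sym)

lemma submult_ennreal: "ennreal (g (x + y)) \<le> ennreal (g x) * ennreal (g y)"
  using submult by (simp add: ennreal_mult[symmetric] nonneg)

text \<open>The factors by which Gaussian smoothing can increase and decrease the weight: both
\<open>g (x + w) \<le> g x * g w\<close> and \<open>g x / g w \<le> g (x + w)\<close> are integrated against the kernel in \<open>w\<close>.  In
the lower factor \<open>w\<close> is kept in the unit ball, so that the estimate can be localised to balls.\<close>

definition "upper_const = (\<integral>\<^sup>+w. ennreal (g w * gauss_kernel w) \<partial>lborel)"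
definition "lower_const = (\<integral>\<^sup>+w\<in>cball 0 1. ennreal (gauss_kernel w / g w) \<partial>lborel)"

lemma upper_const_finite: "upper_const < \<infinity>"
proof -
  have "g w * gauss_kernel w \<le> (C * exp (\<kappa>\<^sup>2)) * exp (- (norm w)\<^sup>2 / 4)" for w
  proof -
    have "0 \<le> (norm w / 2 - \<kappa>)\<^sup>2" by simp
    then have "\<kappa> * norm w + - (norm w)\<^sup>2 / 2 \<le> \<kappa>\<^sup>2 + - (norm w)\<^sup>2 / 4"
      by (simp add: power2_eq_square field_simps)
    then have "exp (\<kappa> * norm w) * gauss_kernel w \<le> exp (\<kappa>\<^sup>2) * exp (- (norm w)\<^sup>2 / 4)"
      unfolding gauss_kernel_def exp_add[symmetric] by simp
    moreover have "g w * gauss_kernel w \<le> C * exp (\<kappa> * norm w) * gauss_kernel w"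
      using growth by (intro mult_right_mono) (auto simp: gauss_kernel_pos less_imp_le)
    ultimately show ?thesis 
      using const_pos by (smt (verit) mult.assoc mult_left_mono)
  qed
  then have "upper_const \<le> (\<integral>\<^sup>+w. ennreal (C * exp (\<kappa>\<^sup>2)) * ennreal (exp (- (norm w)\<^sup>2 / 4)) \<partial>(lborel :: 'a measure))"
    unfolding upper_const_def using const_pos
    by (intro nn_integral_mono) (auto simp: ennreal_mult[symmetric])
  also have "\<dots> = ennreal (C * exp (\<kappa>\<^sup>2)) * (\<integral>\<^sup>+w. ennreal (exp (- (norm w)\<^sup>2 / 4)) \<partial>(lborel :: 'a measure))"
    by (rule nn_integral_cmult) measurable
  also have "\<dots> < \<infinity>"
    using nn_integral_exp_minus_norm_square_finite[where 'a = 'a] by (simp add: ennreal_mult_less_top)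
  finally show ?thesis .
qed

lemma lower_const_pos: "lower_const \<noteq> 0"
proof
  assume "lower_const = 0"
  then have "AE w in (lborel :: 'a measure). ennreal (gauss_kernel w / g w) * indicator (cball 0 1) w = 0"
    unfolding lower_const_def by (subst (asm) nn_integral_0_iff_AE) auto
  then have "AE w in (lborel :: 'a measure). w \<notin> cball 0 1"
  proof eventually_elim
    case (elim w)
    have "0 < gauss_kernel w / g w" 
      using ge_1[of w] by (intro divide_pos_pos) (auto simp: gauss_kernel_pos)
    then show ?case using elim by (auto simp: ennreal_eq_0_iff split: split_indicator_asm)
  qed
  then have "emeasure lborel (cball (0::'a) 1) = 0"
    by (subst (asm) AE_iff_measurable[of "cball 0 1"]) auto
  moreover have "0 < measure lborel (cball (0::'a) 1)"
    by (rule content_cball_pos) simp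
  ultimately show False by (simp add: measure_def)
qed

lemma nn_integral_smooth_le:
  assumes \<mu>: "prob_space \<mu>" "sets \<mu> = sets borel"
  shows "(\<integral>\<^sup>+y. ennreal (g y) * ennreal (gauss_smooth \<mu> y) \<partial>lborel) \<le> upper_const * (\<integral>\<^sup>+x. g x \<partial>\<mu>)"
proof -
  note \<mu>(2)[measurable_cong]
  have "(\<integral>\<^sup>+y. ennreal (g y) * ennreal (gauss_smooth \<mu> y) \<partial>lborel) =
      (\<integral>\<^sup>+x. (\<integral>\<^sup>+w. ennreal (g (x + w)) * ennreal (gauss_kernel w) \<partial>lborel) \<partial>\<mu>)"
    by (rule nn_integral_gauss_smooth[OF \<mu>]) measurable
  also have "\<dots> \<le> (\<integral>\<^sup>+x. (\<integral>\<^sup>+w. ennreal (g x) * ennreal (g w * gauss_kernel w) \<partial>lborel) \<partial>\<mu>)"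
    using submult 
    by (intro nn_integral_mono) (auto simp: ennreal_mult[symmetric] nonneg gauss_kernel_pos less_imp_le
      mult.assoc[symmetric] intro!: mult_right_mono ennreal_leI)
  also have "\<dots> = upper_const * (\<integral>\<^sup>+x. g x \<partial>\<mu>)"
    unfolding upper_const_def by (simp add: nn_integral_cmult nn_integral_multc mult.commute)
  finally show ?thesis .
qed

text \<open>A point of the ball of radius \<open>r\<close> moved by at most one stays in the ball of radius \<open>r + 1\<close>.\<close>

lemma nn_integral_smooth_ball_ge:
  assumes \<mu>: "prob_space \<mu>" "sets \<mu> = sets borel"
  shows "lower_const * (\<integral>\<^sup>+x\<in>cball 0 r. g x \<partial>\<mu>) \<le>
    (\<integral>\<^sup>+y\<in>cball 0 (r + 1). ennreal (g y) * ennreal (gauss_smooth \<mu> y) \<partial>lborel)"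
proof -
  note \<mu>(2)[measurable_cong]
  have "lower_const * (\<integral>\<^sup>+x\<in>cball 0 r. g x \<partial>\<mu>) =
     (\<integral>\<^sup>+x. (\<integral>\<^sup>+w. (ennreal (g x) * indicator (cball 0 r) x) * (ennreal (gauss_kernel w / g w) * indicator (cball 0 1) w) \<partial>lborel) \<partial>\<mu>)"
    unfolding lower_const_def by (simp add: nn_integral_cmult nn_integral_multc mult.commute)
  also have "\<dots> \<le> (\<integral>\<^sup>+x. (\<integral>\<^sup>+w. ennreal (g (x + w)) * indicator (cball 0 (r + 1)) (x + w) * ennreal (gauss_kernel w) \<partial>lborel) \<partial>\<mu>)"
  proof (intro nn_integral_mono)
    fix x w
    show "(ennreal (g x) * indicator (cball 0 r) x) * (ennreal (gauss_kernel w / g w) * indicator (cball 0 1) w) \<le>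
      ennreal (g (x + w)) * indicator (cball 0 (r + 1)) (x + w) * ennreal (gauss_kernel w)"
    proof (cases "x \<in> cball 0 r \<and> w \<in> cball 0 1")
      case True
      then have "x + w \<in> cball 0 (r + 1)"
        using norm_triangle_ineq[of x w] by auto
      moreover have "g x * (gauss_kernel w / g w) \<le> g (x + w) * gauss_kernel w"
        using submult_sub[of x w] ge_1[of w] gauss_kernel_pos[of w]
        by (simp add: field_simps) 
      ultimately show ?thesis using True 
        by (simp add: ennreal_mult[symmetric] nonneg gauss_kernel_pos less_imp_le ennreal_leI)
    qed (auto split: split_indicator)
  qed
  also have "\<dots> = (\<integral>\<^sup>+y. (ennreal (g y) * indicator (cball 0 (r + 1)) y) * ennreal (gauss_smooth \<mu> y) \<partial>lborel)"
    by (rule nn_integral_gauss_smooth[OF \<mu>, symmetric]) measurable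
  finally show ?thesis by (simp add: ac_simps)
qed

lemma nn_integral_smooth_ge:
  assumes \<mu>: "prob_space \<mu>" "sets \<mu> = sets borel"
  shows "lower_const * (\<integral>\<^sup>+x. g x \<partial>\<mu>) \<le>
    (\<integral>\<^sup>+y. ennreal (g y) * ennreal (gauss_smooth \<mu> y) \<partial>lborel)"
proof -
  note \<mu>(2)[measurable_cong]
  have "lower_const * (\<integral>\<^sup>+x. g x \<partial>\<mu>) =
     (\<integral>\<^sup>+x. (\<integral>\<^sup>+w. ennreal (g x) * (ennreal (gauss_kernel w / g w) * indicator (cball 0 1) w) \<partial>lborel) \<partial>\<mu>)"
    unfolding lower_const_def by (simp add: nn_integral_cmult nn_integral_multc mult.commute)
  also have "\<dots> \<le> (\<integral>\<^sup>+x. (\<integral>\<^sup>+w. ennreal (g (x + w)) * ennreal (gauss_kernel w) \<partial>lborel) \<partial>\<mu>)"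
  proof (intro nn_integral_mono)
    fix x w
    have "g x * (gauss_kernel w / g w) \<le> g (x + w) * gauss_kernel w"
      using submult_sub[of x w] ge_1[of w] gauss_kernel_pos[of w]
      by (simp add: field_simps) 
    then show "ennreal (g x) * (ennreal (gauss_kernel w / g w) * indicator (cball 0 1) w) \<le>
      ennreal (g (x + w)) * ennreal (gauss_kernel w)"
      by (auto simp: ennreal_mult[symmetric] nonneg gauss_kernel_pos less_imp_le ennreal_leI 
          split: split_indicator)
  qed
  also have "\<dots> = (\<integral>\<^sup>+y. ennreal (g y) * ennreal (gauss_smooth \<mu> y) \<partial>lborel)"
    by (rule nn_integral_gauss_smooth[OF \<mu>, symmetric]) measurable
  finally show ?thesis .
qed

text \<open>Fatou's lemma for the smoothed densities, whose pointwise convergence is all that is known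
of the laws.\<close>

lemma nn_integral_finite_of_char_fun_limit:
  assumes \<mu>: "prob_space \<mu>" "sets \<mu> = sets borel"
    and \<nu>: "\<And>n. prob_space (\<nu> n)" "\<And>n. sets (\<nu> n) = sets borel"
    and lim: "\<And>z. (\<lambda>n. char_fun (\<nu> n) z) \<longlonglongrightarrow> char_fun \<mu> z"
    and B: "\<And>n. (\<integral>\<^sup>+x. g x \<partial>\<nu> n) \<le> B" "B < \<infinity>"
  shows "(\<integral>\<^sup>+x. g x \<partial>\<mu>) < \<infinity>"
proof -
  have "(\<integral>\<^sup>+y. ennreal (g y) * ennreal (gauss_smooth \<mu> y) \<partial>lborel) =
     (\<integral>\<^sup>+y. liminf (\<lambda>n. ennreal (g y) * ennreal (gauss_smooth (\<nu> n) y)) \<partial>lborel)"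
  proof (intro nn_integral_cong)
    fix y
    have "(\<lambda>n. ennreal (g y * gauss_smooth (\<nu> n) y)) \<longlonglongrightarrow> ennreal (g y * gauss_smooth \<mu> y)"
      by (intro tendsto_ennrealI tendsto_mult tendsto_const gauss_smooth_tendsto \<mu> \<nu> lim)
    then have "(\<lambda>n. ennreal (g y) * ennreal (gauss_smooth (\<nu> n) y)) \<longlonglongrightarrow> ennreal (g y) * ennreal (gauss_smooth \<mu> y)"
      by (simp add: ennreal_mult nonneg gauss_smooth_bounds \<mu> \<nu>)
    then show "ennreal (g y) * ennreal (gauss_smooth \<mu> y) = liminf (\<lambda>n. ennreal (g y) * ennreal (gauss_smooth (\<nu> n) y))"
      by (intro lim_imp_Liminf[symmetric]) auto
  qed
  also have "\<dots> \<le> liminf (\<lambda>n. \<integral>\<^sup>+y. ennreal (g y) * ennreal (gauss_smooth (\<nu> n) y) \<partial>lborel)"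
    using gauss_smooth_measurable[OF \<nu>, measurable]
    by (intro nn_integral_liminf) measurable
  also have "\<dots> \<le> upper_const * B"
  proof (rule Liminf_le)
    show "\<forall>\<^sub>F n in sequentially. (\<integral>\<^sup>+y. ennreal (g y) * ennreal (gauss_smooth (\<nu> n) y) \<partial>lborel) \<le> upper_const * B"
      by (intro always_eventually allI order_trans[OF nn_integral_smooth_le[OF \<nu>]] mult_left_mono B) auto
  qed simp
  also have "\<dots> < \<infinity>"
    using upper_const_finite B by (simp add: ennreal_mult_less_top)
  finally have "lower_const * (\<integral>\<^sup>+x. g x \<partial>\<mu>) < \<infinity>"
    using nn_integral_smooth_ge[OF \<mu>] by (rule le_less_trans[rotated])
  then show ?thesis
    using lower_const_pos by (auto simp: ennreal_mult_less_top)
qed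

text \<open>The complementary direction needs an upper bound for a limit, which Fatou's lemma does not
give.  On a ball the weight is bounded and the smoothed densities are at most one, so the integrals
converge by dominated convergence.\<close>

lemma nn_integral_balls_le_of_char_fun_limit:
  assumes \<mu>: "prob_space \<mu>" "sets \<mu> = sets borel"
    and \<nu>: "\<And>n. prob_space (\<nu> n)" "\<And>n. sets (\<nu> n) = sets borel"
    and lim: "\<And>z. (\<lambda>n. char_fun (\<nu> n) z) \<longlonglongrightarrow> char_fun \<mu> z"
    and A: "\<And>n. A \<le> (\<integral>\<^sup>+x\<in>cball 0 r. g x \<partial>\<nu> n)"
  shows "lower_const * A \<le> upper_const * (\<integral>\<^sup>+x. g x \<partial>\<mu>)"
proof -
  let ?I = "\<lambda>\<mu>. \<integral>\<^sup>+y. ennreal (g y) * ennreal (gauss_smooth \<mu> y) * indicator (cball 0 (r + 1)) y \<partial>lborel"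
  note gauss_smooth_measurable[OF \<nu>, measurable] gauss_smooth_measurable[OF \<mu>, measurable]
  have "(\<lambda>n. ?I (\<nu> n)) \<longlonglongrightarrow> ?I \<mu>"
  proof (rule nn_integral_dominated_convergence
      [where w = "\<lambda>y. ennreal (C * exp (\<kappa> * (r + 1))) * indicator (cball 0 (r + 1)) y"])
    show "(\<integral>\<^sup>+y. ennreal (C * exp (\<kappa> * (r + 1))) * indicator (cball (0::'a) (r + 1)) y \<partial>lborel) < \<infinity>"
      by (simp add: nn_integral_cmult_indicator ennreal_mult_less_top emeasure_lborel_cball_finite[unfolded infinity_ennreal_def])
    show "AE y in lborel. (\<lambda>n. ennreal (g y) * ennreal (gauss_smooth (\<nu> n) y) * indicator (cball 0 (r + 1)) y)
        \<longlonglongrightarrow> ennreal (g y) * ennreal (gauss_smooth \<mu> y) * indicator (cball 0 (r + 1)) y"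
    proof (intro AE_I2)
      fix y
      have "(\<lambda>n. ennreal (g y * gauss_smooth (\<nu> n) y * indicator (cball 0 (r + 1)) y)) \<longlonglongrightarrow> ennreal (g y * gauss_smooth \<mu> y * indicator (cball 0 (r + 1)) y)"
        by (intro tendsto_ennrealI tendsto_mult tendsto_const gauss_smooth_tendsto \<mu> \<nu> lim)
      then show "(\<lambda>n. ennreal (g y) * ennreal (gauss_smooth (\<nu> n) y) * indicator (cball 0 (r + 1)) y)
        \<longlonglongrightarrow> ennreal (g y) * ennreal (gauss_smooth \<mu> y) * indicator (cball 0 (r + 1)) y"
        by (simp add: ennreal_mult nonneg gauss_smooth_bounds \<mu> \<nu> ennreal_indicator)
    qed
    show "AE y in lborel. ennreal (g y) * ennreal (gauss_smooth (\<nu> n) y) * indicator (cball 0 (r + 1)) y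
        \<le> ennreal (C * exp (\<kappa> * (r + 1))) * indicator (cball 0 (r + 1)) y" for n
    proof (intro AE_I2)
      fix y
      have "g y * gauss_smooth (\<nu> n) y \<le> C * exp (\<kappa> * (r + 1))" if "norm y \<le> r + 1"
      proof -
        have "g y * gauss_smooth (\<nu> n) y \<le> g y"
          using gauss_smooth_bounds[OF \<nu>] nonneg by (intro mult_left_le) auto
        also have "\<dots> \<le> C * exp (\<kappa> * norm y)" by (rule growth)
        also have "\<dots> \<le> C * exp (\<kappa> * (r + 1))"
          using that const_pos rate_pos by auto
        finally show ?thesis .
      qed
      then show "ennreal (g y) * ennreal (gauss_smooth (\<nu> n) y) * indicator (cball 0 (r + 1)) y
        \<le> ennreal (C * exp (\<kappa> * (r + 1))) * indicator (cball 0 (r + 1)) y"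
        by (auto split: split_indicator simp: ennreal_mult[symmetric] nonneg gauss_smooth_bounds \<nu> intro!: ennreal_leI)
    qed
  qed measurable
  moreover have "lower_const * A \<le> ?I (\<nu> n)" for n
    using order_trans[OF mult_left_mono[OF A] nn_integral_smooth_ball_ge[OF \<nu>]] by simp
  ultimately have "lower_const * A \<le> ?I \<mu>"
    by (intro LIMSEQ_le_const) auto
  also have "\<dots> \<le> (\<integral>\<^sup>+y. ennreal (g y) * ennreal (gauss_smooth \<mu> y) \<partial>lborel)"
    by (intro nn_integral_mono) (auto split: split_indicator)
  also have "\<dots> \<le> upper_const * (\<integral>\<^sup>+x. g x \<partial>\<mu>)"
    by (rule nn_integral_smooth_le[OF \<mu>])
  finally show ?thesis .
qed

end

section \<open>Truncating the small jumps of an infinitely divisible law\<close>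

lemma abs_exp_minus_linear_le: "\<bar>exp u - 1 - u\<bar> \<le> u\<^sup>2 * exp \<bar>u\<bar>" for u :: real
proof -
  obtain t where t: "\<bar>t\<bar> \<le> \<bar>u\<bar>" "exp u = (\<Sum>m<2. u ^ m / fact m) + exp t / fact 2 * u ^ 2"
    using Maclaurin_exp_le[of u 2] by blast
  then have "exp u - 1 - u = exp t / 2 * u\<^sup>2"
    by (simp add: numeral_2_eq_2)
  then have "\<bar>exp u - 1 - u\<bar> = exp t / 2 * u\<^sup>2" by (simp only: abs_of_nonneg) auto
  also have "\<dots> \<le> exp \<bar>u\<bar> * u\<^sup>2"
  proof (rule mult_right_mono)
    have "exp t \<le> exp \<bar>u\<bar>" using t(1) by simp
    then show "exp t / 2 \<le> exp \<bar>u\<bar>" using exp_gt_zero[of t] by linarith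
  qed simp
  finally show ?thesis by (simp add: mult.commute)
qed

text \<open>Reduces exponential moments of the norm to moments of \<open>exp (w \<bullet> x)\<close>, which are
multiplicative and hence explicit for compound Poisson laws: the norm is at most the dimension times
the largest coordinate in absolute value.\<close>

lemma exp_norm_le_sum_exp:
  fixes x :: "'a::euclidean_space"
  assumes "0 \<le> \<kappa>"
  defines "d \<equiv> real DIM('a)"
  shows "exp (\<kappa> * norm x) \<le>
    (\<Sum>i\<in>Basis. exp (((\<kappa> * d) *\<^sub>R i) \<bullet> x) + exp ((- (\<kappa> * d) *\<^sub>R i) \<bullet> x))"
proof -
  have "Max ((\<lambda>j. \<bar>x \<bullet> j\<bar>) ` Basis) \<in> (\<lambda>j. \<bar>x \<bullet> j\<bar>) ` Basis"
    by (rule Max_in) auto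
  then obtain i where i: "i \<in> Basis" and Max: "Max ((\<lambda>j. \<bar>x \<bullet> j\<bar>) ` Basis) = \<bar>x \<bullet> i\<bar>"
    by (rule imageE) simp
  have "norm x \<le> (\<Sum>j\<in>Basis. \<bar>x \<bullet> j\<bar>)" by (rule norm_le_l1)
  also have "\<dots> \<le> (\<Sum>j\<in>(Basis::'a set). \<bar>x \<bullet> i\<bar>)"
    unfolding Max[symmetric] by (intro sum_mono Max_ge) auto
  also have "\<dots> = d * \<bar>x \<bullet> i\<bar>" by (simp add: d_def)
  finally have "exp (\<kappa> * norm x) \<le> exp (\<kappa> * (d * \<bar>x \<bullet> i\<bar>))"
    using assms(1) by (simp add: mult_left_mono)
  also have "\<dots> \<le> exp (((\<kappa> * d) *\<^sub>R i) \<bullet> x) + exp ((- (\<kappa> * d) *\<^sub>R i) \<bullet> x)"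
    by (cases "0 \<le> x \<bullet> i") (auto simp: inner_commute mult.assoc)
  also have "\<dots> \<le> (\<Sum>i\<in>Basis. exp (((\<kappa> * d) *\<^sub>R i) \<bullet> x) + exp ((- (\<kappa> * d) *\<^sub>R i) \<bullet> x))"
    by (rule member_le_sum[OF i]) auto
  finally show ?thesis .
qed

definition levy_integrand :: "'a::euclidean_space \<Rightarrow> 'a \<Rightarrow> complex" where
  "levy_integrand z x = iexp (z \<bullet> x) - 1 - \<i> * of_real ((z \<bullet> x) / (1 + (norm x)\<^sup>2))"

lemma levy_integrand_measurable [measurable]: "levy_integrand z \<in> borel_measurable borel"
  unfolding levy_integrand_def by measurable

lemma one_plus_norm_sq_pos: "0 < 1 + (norm x)\<^sup>2"
  by (simp add: add_pos_nonneg)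

lemma abs_drift_le:
  fixes z x :: "'a::euclidean_space"
  shows "\<bar>(z \<bullet> x) / (1 + (norm x)\<^sup>2)\<bar> \<le> norm z"
proof -
  have "0 \<le> (norm x - 1/2)\<^sup>2" by simp
  then have "norm x \<le> 1 + (norm x)\<^sup>2" by (simp add: power2_eq_square field_simps)
  then have "\<bar>z \<bullet> x\<bar> \<le> norm z * (1 + (norm x)\<^sup>2)"
    using Cauchy_Schwarz_ineq2[of z x] by (meson mult_left_mono norm_ge_zero order_trans)
  then show ?thesis
    using one_plus_norm_sq_pos[of x] by (simp add: abs_divide pos_divide_le_eq)
qed

lemma abs_drift_error_le:
  fixes z x :: "'a::euclidean_space"
  assumes "norm x \<le> 1"
  shows "\<bar>z \<bullet> x - (z \<bullet> x) / (1 + (norm x)\<^sup>2)\<bar> \<le> norm z * (norm x)\<^sup>2"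
proof -
  have "z \<bullet> x - (z \<bullet> x) / (1 + (norm x)\<^sup>2) = (z \<bullet> x) * ((norm x)\<^sup>2 / (1 + (norm x)\<^sup>2))"
    using one_plus_norm_sq_pos[of x] by (simp add: field_simps)
  also have "\<bar>\<dots>\<bar> = \<bar>z \<bullet> x\<bar> * ((norm x)\<^sup>2 / (1 + (norm x)\<^sup>2))"
    by (simp add: abs_mult abs_divide abs_of_pos[OF one_plus_norm_sq_pos])
  also have "\<dots> \<le> norm z * (norm x)\<^sup>2"
  proof (rule mult_mono)
    show "\<bar>z \<bullet> x\<bar> \<le> norm z"
      using Cauchy_Schwarz_ineq2[of z x] assms mult_left_le[of "norm x" "norm z"] by simp
    show "(norm x)\<^sup>2 / (1 + (norm x)\<^sup>2) \<le> (norm x)\<^sup>2"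
      using one_plus_norm_sq_pos[of x] by (simp add: pos_divide_le_eq mult_left_le field_simps)
  qed auto
  finally show ?thesis .
qed

text \<open>The second-order Taylor bound handles the unit ball, where the drift \<open>(z \<bullet> x) / (1 + (norm x)\<^sup>2)\<close>
differs from \<open>z \<bullet> x\<close> by a term of third order; outside the ball everything is bounded.\<close>

lemma norm_levy_integrand_le:
  "cmod (levy_integrand z x) \<le> (2 + norm z + (norm z)\<^sup>2) * min ((norm x)\<^sup>2) 1"
proof (cases "norm x \<le> 1")
  case True
  have "cmod (iexp (z \<bullet> x) - (1 + \<i> * (z \<bullet> x))) \<le> (z \<bullet> x)\<^sup>2 / 2"
    using iexp_approx1[of "z \<bullet> x" 1] by (simp add: numeral_2_eq_2)
  also have "(z \<bullet> x)\<^sup>2 / 2 \<le> (z \<bullet> x)\<^sup>2" by simp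
  also have "\<dots> \<le> (norm z)\<^sup>2 * (norm x)\<^sup>2"
    using power_mono[OF Cauchy_Schwarz_ineq2[of z x], of 2]
    by (simp add: power_mult_distrib)
  finally have 1: "cmod (iexp (z \<bullet> x) - (1 + \<i> * (z \<bullet> x))) \<le> (norm z)\<^sup>2 * (norm x)\<^sup>2" .
  have "levy_integrand z x = (iexp (z \<bullet> x) - (1 + \<i> * (z \<bullet> x))) +
      \<i> * of_real (z \<bullet> x - (z \<bullet> x) / (1 + (norm x)\<^sup>2))"
    unfolding levy_integrand_def of_real_diff by (simp only: algebra_simps)
  also have "cmod \<dots> \<le> cmod (iexp (z \<bullet> x) - (1 + \<i> * (z \<bullet> x))) +
      cmod (\<i> * of_real (z \<bullet> x - (z \<bullet> x) / (1 + (norm x)\<^sup>2)))"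
    by (rule norm_triangle_ineq)
  also have "cmod (\<i> * of_real (z \<bullet> x - (z \<bullet> x) / (1 + (norm x)\<^sup>2))) = \<bar>z \<bullet> x - (z \<bullet> x) / (1 + (norm x)\<^sup>2)\<bar>"
    by (simp only: norm_mult norm_ii norm_of_real mult_1)
  finally have "cmod (levy_integrand z x) \<le> cmod (iexp (z \<bullet> x) - (1 + \<i> * (z \<bullet> x))) +
      \<bar>z \<bullet> x - (z \<bullet> x) / (1 + (norm x)\<^sup>2)\<bar>"
    .
  also have "\<dots> \<le> (norm z)\<^sup>2 * (norm x)\<^sup>2 + norm z * (norm x)\<^sup>2"
    by (intro add_mono 1 abs_drift_error_le True)
  also have "\<dots> \<le> (2 + norm z + (norm z)\<^sup>2) * (norm x)\<^sup>2"
    by (simp add: algebra_simps)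
  also have "(norm x)\<^sup>2 = min ((norm x)\<^sup>2) 1" using True by (simp add: power_le_one)
  finally show ?thesis .
next
  case False
  have "cmod (levy_integrand z x) \<le> cmod (iexp (z \<bullet> x) - 1) + cmod (\<i> * of_real ((z \<bullet> x) / (1 + (norm x)\<^sup>2)))"
    unfolding levy_integrand_def by (rule norm_triangle_ineq4)
  also have "cmod (\<i> * of_real ((z \<bullet> x) / (1 + (norm x)\<^sup>2))) = \<bar>(z \<bullet> x) / (1 + (norm x)\<^sup>2)\<bar>"
    by (simp only: norm_mult norm_ii norm_of_real mult_1)
  also have "cmod (iexp (z \<bullet> x) - 1) + \<bar>(z \<bullet> x) / (1 + (norm x)\<^sup>2)\<bar> \<le> 2 + norm z"
    using norm_triangle_ineq4[of "iexp (z \<bullet> x)" 1] abs_drift_le[of z x] by simp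
  also have "\<dots> \<le> 2 + norm z + (norm z)\<^sup>2" by simp
  also have "\<dots> = (2 + norm z + (norm z)\<^sup>2) * min ((norm x)\<^sup>2) 1"
    using one_le_power[of "norm x" 2] False by (simp add: min_absorb2)
  finally show ?thesis .
qed

definition small_jumps :: "'a::euclidean_space measure \<Rightarrow> real \<Rightarrow> 'a measure" where
  "small_jumps M \<epsilon> = density M (\<lambda>x. ennreal (indicator {x. \<epsilon> < norm x \<and> norm x \<le> 1} x))"

definition large_jumps :: "'a::euclidean_space measure \<Rightarrow> 'a measure" where
  "large_jumps M = density M (\<lambda>x. ennreal (indicator {x. 1 < norm x} x))"

context
  fixes M :: "'a::euclidean_space measure"
  assumes levy: "levy_measure M"
begin

lemma sets_levy: "sets M = sets borel"
  using levy by (simp add: levy_measure_def)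

context
  notes sets_levy [measurable_cong]
begin

lemma integrable_min_norm_sq: "integrable M (\<lambda>x. min ((norm x)\<^sup>2) 1)"
  using levy by (intro integrableI_bounded) (auto simp: levy_measure_def)

text \<open>All integrals against a L\'evy measure below are of this type: quadratic at the origin and
bounded at infinity.\<close>

lemma levy_integrableI:
  fixes f :: "'a \<Rightarrow> 'b::{banach, second_countable_topology}"
  assumes "f \<in> borel_measurable borel" "\<And>x. norm (f x) \<le> K * min ((norm x)\<^sup>2) 1"
  shows "integrable M f"
proof (rule Bochner_Integration.integrable_bound)
  show "integrable M (\<lambda>x. K * min ((norm x)\<^sup>2) 1)"
    by (intro integrable_mult_right integrable_min_norm_sq)
  show "f \<in> borel_measurable M" using assms(1) by simp
  show "AE x in M. norm (f x) \<le> norm (K * min ((norm x)\<^sup>2) 1)"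
    using assms(2) by (intro AE_I2) (smt (verit) real_norm_def)
qed

lemma levy_integrable_off_ball:
  fixes f :: "'a \<Rightarrow> 'b::{banach, second_countable_topology}"
  assumes [measurable]: "f \<in> borel_measurable borel" "S \<in> sets borel"
    and \<epsilon>: "0 < \<epsilon>" "\<epsilon> \<le> 1" and S: "\<And>x. x \<in> S \<Longrightarrow> \<epsilon> < norm x"
    and bd: "\<And>x. x \<in> S \<Longrightarrow> norm (f x) \<le> K"
  shows "integrable M (\<lambda>x. indicator S x *\<^sub>R f x)"
proof (rule levy_integrableI)
  show "norm (indicator S x *\<^sub>R f x) \<le> (\<bar>K\<bar> / \<epsilon>\<^sup>2) * min ((norm x)\<^sup>2) 1" for x
  proof (cases "x \<in> S")
    case True
    have "\<epsilon>\<^sup>2 \<le> min ((norm x)\<^sup>2) 1"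
      using S[OF True] \<epsilon> by (simp add: power_mono power_le_one)
    then have "\<bar>K\<bar> * \<epsilon>\<^sup>2 \<le> \<bar>K\<bar> * min ((norm x)\<^sup>2) 1" by (rule mult_left_mono) simp
    then have "\<bar>K\<bar> \<le> (\<bar>K\<bar> / \<epsilon>\<^sup>2) * min ((norm x)\<^sup>2) 1"
      using \<epsilon> by (simp add: field_simps)
    with bd[OF True] True show ?thesis by simp
  qed simp
qed measurable

lemma finite_measure_density_off_ball:
  assumes \<epsilon>: "0 < \<epsilon>" "\<epsilon> \<le> 1" and [measurable]: "S \<in> sets borel" and S: "\<And>x. x \<in> S \<Longrightarrow> \<epsilon> < norm x"
  shows "finite_measure (density M (\<lambda>x. ennreal (indicator S x)))"
proof (rule finite_measureI)
  have "integrable M (\<lambda>x. indicator S x *\<^sub>R (1::real))"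
    by (rule levy_integrable_off_ball[OF _ _ \<epsilon> S, where K=1]) auto
  then have "(\<integral>\<^sup>+x. ennreal (indicator S x) \<partial>M) < \<infinity>"
    by (simp add: integrable_iff_bounded)
  then show "emeasure (density M (\<lambda>x. ennreal (indicator S x))) (space (density M (\<lambda>x. ennreal (indicator S x)))) \<noteq> \<infinity>"
    by (subst emeasure_density) auto
qed

lemma sets_jumps: "sets (small_jumps M \<epsilon>) = sets borel" "sets (large_jumps M) = sets borel"
  by (simp_all add: small_jumps_def large_jumps_def sets_levy)

lemma finite_measure_large_jumps: "finite_measure (large_jumps M)"
  unfolding large_jumps_def by (rule finite_measure_density_off_ball[where \<epsilon>=1]) auto

lemma finite_measure_small_jumps: "0 < \<epsilon> \<Longrightarrow> \<epsilon> \<le> 1 \<Longrightarrow> finite_measure (small_jumps M \<epsilon>)"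
  unfolding small_jumps_def by (rule finite_measure_density_off_ball[where \<epsilon>=\<epsilon>]) auto

text \<open>The drift of the truncated law, compensating all jumps of size greater than \<open>\<epsilon>\<close>.  It may
diverge as \<open>\<epsilon> \<rightarrow> 0\<close>; only its combination with the jump integral converges.\<close>

definition truncated_drift :: "'a \<Rightarrow> real \<Rightarrow> 'a" where
  "truncated_drift b \<epsilon> = b - (LINT x|M. indicator {x. \<epsilon> < norm x} x *\<^sub>R (x /\<^sub>R (1 + (norm x)\<^sup>2)))"

lemma inner_truncated_drift:
  assumes \<epsilon>: "0 < \<epsilon>" "\<epsilon> \<le> 1"
  shows "z \<bullet> truncated_drift b \<epsilon> = z \<bullet> b - (LINT x|M. indicator {x. \<epsilon> < norm x} x *\<^sub>R ((z \<bullet> x) / (1 + (norm x)\<^sup>2)))"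
proof -
  have "integrable M (\<lambda>x. indicator {x. \<epsilon> < norm x} x *\<^sub>R (x /\<^sub>R (1 + (norm x)\<^sup>2)))"
  proof (rule levy_integrable_off_ball[OF _ _ \<epsilon>])
    show "norm (x /\<^sub>R (1 + (norm x)\<^sup>2)) \<le> 1" for x :: 'a
    proof -
      have "0 \<le> (norm x - 1/2)\<^sup>2" by simp
      then have "norm x \<le> 1 + (norm x)\<^sup>2" by (simp add: power2_eq_square field_simps)
      then show ?thesis using one_plus_norm_sq_pos[of x]
        by (simp add: field_simps abs_of_pos[OF one_plus_norm_sq_pos])
    qed
  qed auto
  from integral_inner_right[OF this, of z] show ?thesis
    unfolding truncated_drift_def inner_diff_right
    by (simp add: divide_inverse ac_simps)
qed

text \<open>Drift, small jumps and large jumps together make up the L\'evy-Khintchine exponent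
restricted to jumps of size greater than \<open>\<epsilon>\<close>.\<close>

lemma truncated_exponent:
  assumes \<epsilon>: "0 < \<epsilon>" "\<epsilon> \<le> 1"
  shows "\<i> * of_real (z \<bullet> truncated_drift b \<epsilon>) + (CLINT x|small_jumps M \<epsilon>. iexp (z \<bullet> x) - 1)
     + (CLINT x|large_jumps M. iexp (z \<bullet> x) - 1)
   = \<i> * of_real (b \<bullet> z) + (CLINT x|M. indicator {x. \<epsilon> < norm x} x *\<^sub>R levy_integrand z x)"
proof -
  let ?e = "\<lambda>x. iexp (z \<bullet> x) - 1"
  let ?q = "\<lambda>x. (z \<bullet> x) / (1 + (norm x)\<^sup>2)"
  let ?S = "{x::'a. \<epsilon> < norm x \<and> norm x \<le> 1}" and ?L = "{x::'a. 1 < norm x}" and ?A = "{x::'a. \<epsilon> < norm x}"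
  have e2: "cmod (?e x) \<le> 2" for x
    by (rule order_trans[OF norm_triangle_ineq4]) simp
  have iS: "integrable M (\<lambda>x. indicator ?S x *\<^sub>R ?e x)"
    by (rule levy_integrable_off_ball[OF _ _ \<epsilon>, where K=2]) (auto simp: e2)
  have iL: "integrable M (\<lambda>x. indicator ?L x *\<^sub>R ?e x)"
    using \<epsilon> by (intro levy_integrable_off_ball[where K=2 and \<epsilon>=1]) (auto simp: e2)
  have iq: "integrable M (\<lambda>x. indicator ?A x *\<^sub>R ?q x)"
    by (rule levy_integrable_off_ball[OF _ _ \<epsilon>, where K="norm z"]) (use abs_drift_le in auto)
  have "(\<lambda>x. indicator ?A x *\<^sub>R levy_integrand z x) =
     (\<lambda>x. indicator ?S x *\<^sub>R ?e x + indicator ?L x *\<^sub>R ?e x - \<i> * of_real (indicator ?A x *\<^sub>R ?q x))"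
    using \<epsilon> by (auto simp: levy_integrand_def fun_eq_iff split: split_indicator)
  then have "(CLINT x|M. indicator ?A x *\<^sub>R levy_integrand z x) =
     (CLINT x|M. indicator ?S x *\<^sub>R ?e x) + (CLINT x|M. indicator ?L x *\<^sub>R ?e x) - \<i> * of_real (LINT x|M. indicator ?A x *\<^sub>R ?q x)"
    using iS iL iq by (simp del: of_real_mult real_scaleR_def of_real_divide of_real_add)
  moreover have "(CLINT x|small_jumps M \<epsilon>. ?e x) = (CLINT x|M. indicator ?S x *\<^sub>R ?e x)"
    unfolding small_jumps_def by (rule integral_density) auto
  moreover have "(CLINT x|large_jumps M. ?e x) = (CLINT x|M. indicator ?L x *\<^sub>R ?e x)"
    unfolding large_jumps_def by (rule integral_density) auto
  ultimately show ?thesis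
    unfolding inner_truncated_drift[OF \<epsilon>]
    by (simp add: algebra_simps inner_commute)
qed

lemma truncated_integral_tendsto:
  "(\<lambda>n. CLINT x|M. indicator {x. inverse (real (Suc n)) < norm x} x *\<^sub>R levy_integrand z x)
    \<longlonglongrightarrow> (CLINT x|M. levy_integrand z x)"
proof (rule integral_dominated_convergence[where w = "\<lambda>x. (2 + norm z + (norm z)\<^sup>2) * min ((norm x)\<^sup>2) 1"])
  show "integrable M (\<lambda>x. (2 + norm z + (norm z)\<^sup>2) * min ((norm x)\<^sup>2) 1)"
    by (intro integrable_mult_right integrable_min_norm_sq)
  show "AE x in M. norm (indicator {x. inverse (real (Suc n)) < norm x} x *\<^sub>R levy_integrand z x)
      \<le> (2 + norm z + (norm z)\<^sup>2) * min ((norm x)\<^sup>2) 1" for n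
    using norm_levy_integrand_le[of z]
    by (intro AE_I2) (auto split: split_indicator intro: order_trans[OF norm_ge_zero])
  show "AE x in M. (\<lambda>n. indicator {x. inverse (real (Suc n)) < norm x} x *\<^sub>R levy_integrand z x) \<longlonglongrightarrow> levy_integrand z x"
  proof (intro AE_I2)
    fix x
    show "(\<lambda>n. indicator {x. inverse (real (Suc n)) < norm x} x *\<^sub>R levy_integrand z x) \<longlonglongrightarrow> levy_integrand z x"
    proof (cases "x = 0")
      case True
      then show ?thesis by (simp add: levy_integrand_def)
    next
      case False
      then have "\<forall>\<^sub>F n in sequentially. inverse (real (Suc n)) < norm x"
        using order_tendstoD(2)[OF LIMSEQ_inverse_real_of_nat, of "norm x"] by simp
      then have "\<forall>\<^sub>F n in sequentially. indicator {x. inverse (real (Suc n)) < norm x} x *\<^sub>R levy_integrand z x = levy_integrand z x"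
        by eventually_elim simp
      then show ?thesis by (rule tendsto_eventually)
    qed
  qed
qed measurable

text \<open>The law of the jumps of size in \<open>(\<epsilon>, 1]\<close>, together with the whole drift.  The point is that
the bound on the exponential moments does not depend on \<open>\<epsilon>\<close>: in the exponent, the first-order part of
\<open>exp (w \<bullet> x) - 1\<close> cancels against the drift, and a remainder quadratic in \<open>x\<close> is left.\<close>

lemma small_jump_law_exists:
  assumes \<epsilon>: "0 < \<epsilon>" "\<epsilon> \<le> 1"
  obtains \<nu> where "prob_space \<nu>" "sets \<nu> = sets borel"
    "\<And>z. char_fun \<nu> z = exp (\<i> * of_real (z \<bullet> truncated_drift b \<epsilon>) + (CLINT x|small_jumps M \<epsilon>. iexp (z \<bullet> x) - 1))"
    "\<And>w. (\<integral>\<^sup>+x. ennreal (exp (w \<bullet> x)) \<partial>\<nu>) \<le>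
       ennreal (exp (w \<bullet> b + ((norm w)\<^sup>2 * exp (norm w) + norm w) * (LINT x|M. min ((norm x)\<^sup>2) 1)))"
proof (rule compound_poisson_exists[OF finite_measure_small_jumps[OF \<epsilon>] sets_jumps(1)])
  fix P assume P: "prob_space P" "sets P = sets borel"
    and char: "\<And>z. char_fun P z = exp (CLINT x|small_jumps M \<epsilon>. iexp (z \<bullet> x) - 1)"
    and mom: "\<And>g. g \<in> borel_measurable borel \<Longrightarrow> (\<And>x. 0 \<le> g x) \<Longrightarrow> g 0 \<le> 1 \<Longrightarrow>
       (\<And>x y. g (x + y) \<le> g x * g y) \<Longrightarrow> integrable (small_jumps M \<epsilon>) g \<Longrightarrow>
       (\<integral>\<^sup>+x. ennreal (g x) \<partial>P) \<le> ennreal (exp (LINT x|small_jumps M \<epsilon>. g x - 1))"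
  let ?a = "truncated_drift b \<epsilon>"
  let ?D = "return borel ?a"
  note P(2)[measurable_cong]
  have D: "prob_space ?D" "sets ?D = sets borel" by (auto intro: prob_space_return)
  show ?thesis
  proof (rule that[of "convolve ?D P"])
    show "prob_space (convolve ?D P)" by (intro prob_space_convolve D P)
    show "sets (convolve ?D P) = sets borel" by simp
    have "char_fun ?D z = iexp (z \<bullet> ?a)" for z
      unfolding char_fun_def by (subst integral_return) auto
    then show "char_fun (convolve ?D P) z = 
        exp (\<i> * of_real (z \<bullet> ?a) + (CLINT x|small_jumps M \<epsilon>. iexp (z \<bullet> x) - 1))" for z
      by (simp add: char_fun_convolve D P char exp_add)
    fix w :: 'a
    let ?S = "{x::'a. \<epsilon> < norm x \<and> norm x \<le> 1}" and ?A = "{x::'a. \<epsilon> < norm x}"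
    let ?q = "\<lambda>x. (w \<bullet> x) / (1 + (norm x)\<^sup>2)"
    let ?K = "(norm w)\<^sup>2 * exp (norm w) + norm w"
    have wx: "w \<bullet> x \<le> norm w" if "norm x \<le> 1" for x
      using Cauchy_Schwarz_ineq2[of w x] mult_left_le[OF that, of "norm w"] by simp
    have iS: "integrable M (\<lambda>x. indicator ?S x *\<^sub>R exp (w \<bullet> x))"
      by (rule levy_integrable_off_ball[OF _ _ \<epsilon>, where K="exp (norm w)"]) (auto simp: wx)
    have iS1: "integrable M (\<lambda>x. indicator ?S x *\<^sub>R (exp (w \<bullet> x) - 1))"
      by (rule levy_integrable_off_ball[OF _ _ \<epsilon>, where K="exp (norm w) + 1"]) 
        (auto intro!: order_trans[OF abs_triangle_ineq4] simp: wx)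
    have iq: "integrable M (\<lambda>x. indicator ?A x *\<^sub>R ?q x)"
      by (rule levy_integrable_off_ball[OF _ _ \<epsilon>, where K="norm w"]) (use abs_drift_le in auto)
    have "integrable (small_jumps M \<epsilon>) (\<lambda>x. exp (w \<bullet> x))"
      unfolding small_jumps_def using iS by (subst integrable_density) auto
    then have "(\<integral>\<^sup>+x. ennreal (exp (w \<bullet> x)) \<partial>P) \<le> ennreal (exp (LINT x|small_jumps M \<epsilon>. exp (w \<bullet> x) - 1))"
      by (intro mom) (auto simp: inner_add_right exp_add)
    also have "(LINT x|small_jumps M \<epsilon>. exp (w \<bullet> x) - 1) = (LINT x|M. indicator ?S x *\<^sub>R (exp (w \<bullet> x) - 1))"
      unfolding small_jumps_def by (rule integral_density) auto
    finally have 1: "(\<integral>\<^sup>+x. ennreal (exp (w \<bullet> x)) \<partial>P) \<le> ennreal (exp (LINT x|M. indicator ?S x *\<^sub>R (exp (w \<bullet> x) - 1)))" .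
    have "(\<integral>\<^sup>+x. ennreal (exp (w \<bullet> x)) \<partial>convolve ?D P) = 
        ennreal (exp (w \<bullet> ?a)) * (\<integral>\<^sup>+x. ennreal (exp (w \<bullet> x)) \<partial>P)"
      by (subst nn_integral_convolve[OF D(1) P(1) D(2) P(2)])
        (auto simp: nn_integral_return inner_add_right exp_add ennreal_mult nn_integral_cmult)
    also have "\<dots> \<le> ennreal (exp (w \<bullet> ?a)) * ennreal (exp (LINT x|M. indicator ?S x *\<^sub>R (exp (w \<bullet> x) - 1)))"
      by (intro mult_left_mono 1) simp
    also have "\<dots> = ennreal (exp (w \<bullet> b + (LINT x|M. indicator ?S x *\<^sub>R (exp (w \<bullet> x) - 1) - indicator ?A x *\<^sub>R ?q x)))"
      unfolding inner_truncated_drift[OF \<epsilon>] Bochner_Integration.integral_diff[OF iS1 iq]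
      by (simp add: ennreal_mult[symmetric] exp_add[symmetric] algebra_simps)
    also have "\<dots> \<le> ennreal (exp (w \<bullet> b + ?K * (LINT x|M. min ((norm x)\<^sup>2) 1)))"
    proof -
      have bd: "indicator ?S x *\<^sub>R (exp (w \<bullet> x) - 1) - indicator ?A x *\<^sub>R ?q x \<le> ?K * min ((norm x)\<^sup>2) 1" for x
      proof -
        consider "norm x \<le> \<epsilon>" | "\<epsilon> < norm x" "norm x \<le> 1" | "1 < norm x" by linarith
        then show ?thesis
        proof cases
          case 1 then show ?thesis by (auto split: split_indicator)
        next
          case 2
          have "\<bar>w \<bullet> x\<bar> \<le> norm w" 
            using Cauchy_Schwarz_ineq2[of w x] mult_left_le[OF 2(2), of "norm w"] by simp
          moreover have "(w \<bullet> x)\<^sup>2 \<le> (norm w)\<^sup>2 * (norm x)\<^sup>2"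
            using power_mono[OF Cauchy_Schwarz_ineq2[of w x], of 2] by (simp add: power_mult_distrib)
          ultimately have "(w \<bullet> x)\<^sup>2 * exp \<bar>w \<bullet> x\<bar> \<le> (norm w)\<^sup>2 * (norm x)\<^sup>2 * exp (norm w)"
            by (intro mult_mono) auto
          then have "exp (w \<bullet> x) - 1 - ?q x \<le> (norm w)\<^sup>2 * (norm x)\<^sup>2 * exp (norm w) + norm w * (norm x)\<^sup>2"
            using abs_exp_minus_linear_le[of "w \<bullet> x"] abs_drift_error_le[OF 2(2), of w] by linarith
          also have "\<dots> = ?K * min ((norm x)\<^sup>2) 1" using 2 by (simp add: power_le_one algebra_simps)
          finally show ?thesis using 2 by simp
        next
          case 3
          then have "min ((norm x)\<^sup>2) 1 = 1" using one_le_power[of "norm x" 2] by (simp add: min_absorb2)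
          moreover have "norm w \<le> ?K" by simp
          then have "- ?q x \<le> ?K" using abs_drift_le[of w x] by linarith
          ultimately show ?thesis using 3 \<epsilon> by simp
        qed
      qed
      have "(LINT x|M. indicator ?S x *\<^sub>R (exp (w \<bullet> x) - 1) - indicator ?A x *\<^sub>R ?q x)
          \<le> (LINT x|M. ?K * min ((norm x)\<^sup>2) 1)"
        by (intro integral_mono Bochner_Integration.integrable_diff iS1 iq integrable_mult_right integrable_min_norm_sq bd)
      then show ?thesis by (intro ennreal_leI) simp
    qed
    finally show "(\<integral>\<^sup>+x. ennreal (exp (w \<bullet> x)) \<partial>convolve ?D P) \<le>
       ennreal (exp (w \<bullet> b + ?K * (LINT x|M. min ((norm x)\<^sup>2) 1)))" .
  qed
qed

end

end

section \<open>The moment criterion for infinitely divisible laws\<close>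

text \<open>The only facts about \<open>\<mu>\<close> that the moment criterion uses: it is the limit, in the sense of
characteristic functions, of laws \<open>\<nu> n * P\<close> where \<open>P\<close> is the compound Poisson law of the large jumps,
fixed along the sequence, and the \<open>\<nu> n\<close> have uniformly bounded exponential moments.\<close>

lemma infinitely_divisible_approximation:
  fixes M :: "'a::euclidean_space measure" and \<kappa> :: real
  assumes id: "is_ID0 M b \<mu>" and \<kappa>: "0 < \<kappa>"
  shows "\<exists>\<nu> P B. (\<forall>n. prob_space (\<nu> n) \<and> sets (\<nu> n) = sets borel) \<and> prob_space P \<and> sets P = sets borel \<and>
     (\<forall>z. (\<lambda>n. char_fun (convolve (\<nu> n) P) z) \<longlonglongrightarrow> char_fun \<mu> z) \<and>
     (\<forall>n. (\<integral>\<^sup>+x. ennreal (exp (\<kappa> * norm x)) \<partial>\<nu> n) \<le> ennreal B) \<and>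
     (\<forall>g. g \<in> borel_measurable borel \<longrightarrow> (\<forall>x. 0 \<le> g x) \<longrightarrow> g 0 \<le> 1 \<longrightarrow>
       (\<forall>x y. g (x + y) \<le> g x * g y) \<longrightarrow> (\<integral>\<^sup>+x. ennreal (g x) \<partial>large_jumps M) < \<infinity> \<longrightarrow>
       (\<integral>\<^sup>+x. ennreal (g x) \<partial>P) < \<infinity>) \<and>
     (\<forall>f. f \<in> borel_measurable borel \<longrightarrow>
       ennreal (exp (- measure (large_jumps M) UNIV)) * (\<integral>\<^sup>+x. f x \<partial>large_jumps M) \<le> (\<integral>\<^sup>+x. f x \<partial>P))"
proof -
  have levy: "levy_measure M" using id by (simp add: is_ID0_def)
  have char: "char_fun \<mu> z = exp (\<i> * of_real (b \<bullet> z) + (CLINT x|M. levy_integrand z x))" for z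
    using id by (simp add: is_ID0_def levy_integrand_def)
  let ?\<epsilon> = "\<lambda>n. inverse (real (Suc n))"
  let ?I = "LINT x|M. min ((norm x)\<^sup>2) 1"
  define E where "E w = exp (w \<bullet> b + ((norm w)\<^sup>2 * exp (norm w) + norm w) * ?I)" for w
  have \<epsilon>: "0 < ?\<epsilon> n" "?\<epsilon> n \<le> 1" for n by (auto simp: inverse_eq_divide)
  have "\<exists>\<nu>. prob_space \<nu> \<and> sets \<nu> = sets borel \<and>
    (\<forall>z. char_fun \<nu> z = exp (\<i> * of_real (z \<bullet> truncated_drift M b (?\<epsilon> n)) + (CLINT x|small_jumps M (?\<epsilon> n). iexp (z \<bullet> x) - 1))) \<and>
    (\<forall>w. (\<integral>\<^sup>+x. ennreal (exp (w \<bullet> x)) \<partial>\<nu>) \<le> ennreal (E w))" for n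
    by (rule small_jump_law_exists[OF levy \<epsilon>(1)[of n] \<epsilon>(2)[of n], of b]) (auto simp: E_def)
  then obtain \<nu> where \<nu>: "\<And>n. prob_space (\<nu> n)" "\<And>n. sets (\<nu> n) = sets borel"
    and \<nu>_char: "\<And>n z. char_fun (\<nu> n) z = exp (\<i> * of_real (z \<bullet> truncated_drift M b (?\<epsilon> n)) + (CLINT x|small_jumps M (?\<epsilon> n). iexp (z \<bullet> x) - 1))"
    and \<nu>_mom: "\<And>n w. (\<integral>\<^sup>+x. ennreal (exp (w \<bullet> x)) \<partial>\<nu> n) \<le> ennreal (E w)"
    by metis
  let ?w = "\<lambda>i::'a. (\<kappa> * real DIM('a)) *\<^sub>R i" and ?w' = "\<lambda>i::'a. (- (\<kappa> * real DIM('a))) *\<^sub>R i"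
  have B: "(\<integral>\<^sup>+x. ennreal (exp (\<kappa> * norm x)) \<partial>\<nu> n) \<le> ennreal (\<Sum>i\<in>Basis. E (?w i) + E (?w' i))" for n
  proof -
    note \<nu>(2)[measurable_cong]
    have "(\<integral>\<^sup>+x. ennreal (exp (\<kappa> * norm x)) \<partial>\<nu> n) \<le>
      (\<integral>\<^sup>+x. (\<Sum>i\<in>Basis. ennreal (exp (?w i \<bullet> x)) + ennreal (exp (?w' i \<bullet> x))) \<partial>\<nu> n)"
      using exp_norm_le_sum_exp[of \<kappa>] \<kappa>
      by (intro nn_integral_mono) (simp add: sum_ennreal sum_nonneg ennreal_plus[symmetric] ennreal_leI
        del: ennreal_plus inner_scaleR_left)
    also have "\<dots> = (\<Sum>i\<in>Basis. (\<integral>\<^sup>+x. ennreal (exp (?w i \<bullet> x)) \<partial>\<nu> n) + (\<integral>\<^sup>+x. ennreal (exp (?w' i \<bullet> x)) \<partial>\<nu> n))"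
      by (subst nn_integral_sum) (auto simp: nn_integral_add simp del: inner_scaleR_left)
    also have "\<dots> \<le> (\<Sum>i\<in>Basis. ennreal (E (?w i)) + ennreal (E (?w' i)))"
      by (intro sum_mono add_mono \<nu>_mom)
    also have "\<dots> = ennreal (\<Sum>i\<in>Basis. E (?w i) + E (?w' i))"
      by (simp add: sum_ennreal E_def ennreal_plus[symmetric] del: ennreal_plus)
    finally show ?thesis .
  qed
  show ?thesis
  proof (rule compound_poisson_exists[OF finite_measure_large_jumps[OF levy] sets_jumps(2)[OF levy]])
    fix P assume P: "prob_space P" "sets P = sets borel"
      and P_char: "\<And>z. char_fun P z = exp (CLINT x|large_jumps M. iexp (z \<bullet> x) - 1)"
      and P_mom: "\<And>g. g \<in> borel_measurable borel \<Longrightarrow> (\<And>x. 0 \<le> g x) \<Longrightarrow> g 0 \<le> 1 \<Longrightarrow>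
       (\<And>x y. g (x + y) \<le> g x * g y) \<Longrightarrow> integrable (large_jumps M) g \<Longrightarrow>
       (\<integral>\<^sup>+x. ennreal (g x) \<partial>P) \<le> ennreal (exp (LINT x|large_jumps M. g x - 1))"
      and P_ge: "\<And>f. f \<in> borel_measurable borel \<Longrightarrow>
       ennreal (exp (- measure (large_jumps M) UNIV)) * (\<integral>\<^sup>+x. f x \<partial>large_jumps M) \<le> (\<integral>\<^sup>+x. f x \<partial>P)"
    have "char_fun (convolve (\<nu> n) P) z =
      exp (\<i> * of_real (b \<bullet> z) + (CLINT x|M. indicator {x. ?\<epsilon> n < norm x} x *\<^sub>R levy_integrand z x))" for n z
      by (simp only: char_fun_convolve[OF \<nu>(1) P(1) \<nu>(2) P(2)] \<nu>_char P_char exp_add[symmetric]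
          truncated_exponent[OF levy \<epsilon>])
    then have lim: "(\<lambda>n. char_fun (convolve (\<nu> n) P) z) \<longlonglongrightarrow> char_fun \<mu> z" for z
      unfolding char by (simp only:) (intro tendsto_exp tendsto_add tendsto_const truncated_integral_tendsto levy)
    have fin: "(\<integral>\<^sup>+x. ennreal (g x) \<partial>P) < \<infinity>"
      if g: "g \<in> borel_measurable borel" "\<forall>x. 0 \<le> g x" "g 0 \<le> 1" "\<forall>x y. g (x + y) \<le> g x * g y"
        and fin: "(\<integral>\<^sup>+x. ennreal (g x) \<partial>large_jumps M) < \<infinity>" for g
    proof -
      have "integrable (large_jumps M) g"
        using g fin by (intro integrableI_nonneg) (auto simp: measurable_cong_sets[OF sets_jumps(2)[OF levy] refl])
      then have "(\<integral>\<^sup>+x. ennreal (g x) \<partial>P) \<le> ennreal (exp (LINT x|large_jumps M. g x - 1))"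
        using g by (intro P_mom) auto
      then show ?thesis by (rule le_less_trans) simp
    qed
    have fin': "\<forall>g. g \<in> borel_measurable borel \<longrightarrow> (\<forall>x. 0 \<le> g x) \<longrightarrow> g 0 \<le> 1 \<longrightarrow>
       (\<forall>x y. g (x + y) \<le> g x * g y) \<longrightarrow> (\<integral>\<^sup>+x. ennreal (g x) \<partial>large_jumps M) < \<infinity> \<longrightarrow>
       (\<integral>\<^sup>+x. ennreal (g x) \<partial>P) < \<infinity>"
      by (intro allI impI) (rule fin)
    show ?thesis
      by (rule exI[of _ \<nu>], rule exI[of _ P], rule exI[of _ "\<Sum>i\<in>Basis. E (?w i) + E (?w' i)"])
        (intro conjI fin' allI impI \<nu> P lim B P_ge)
  qed
qed

text \<open>If the large jumps integrate \<open>g\<close>, then so does \<open>P\<close>, and \<open>g (y + x) \<le> g y * g x\<close> bounds the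
integrals over \<open>\<nu> n * P\<close> uniformly.  Conversely, \<open>\<nu> n\<close> puts at least half of its mass on one fixed
ball, and on it \<open>g x \<le> D * g (y + x)\<close>; so the integral of \<open>g\<close> over \<open>\<nu> n * P\<close> is at least a fixed
multiple of that over \<open>P\<close>, which in turn dominates the one over the large jumps.\<close>

theorem (in submultiplicative_weight) infinitely_divisible_moment_iff:
  assumes id: "is_ID0 M b \<mu>"
  shows "(\<integral>\<^sup>+x. ennreal (g x) \<partial>\<mu>) < \<infinity> \<longleftrightarrow> (\<integral>\<^sup>+x\<in>{x. 1 < norm x}. ennreal (g x) \<partial>M) < \<infinity>"
proof -
  have levy: "levy_measure M" and \<mu>: "prob_space \<mu>" "sets \<mu> = sets borel"
    using id by (auto simp: is_ID0_def)
  note sets_levy[OF levy, measurable_cong]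
  from infinitely_divisible_approximation[OF id rate_pos] obtain \<nu> P B
    where *: "\<forall>n. prob_space (\<nu> n) \<and> sets (\<nu> n) = sets borel"
    and P: "prob_space P" "sets P = sets borel"
    and lim': "\<forall>z. (\<lambda>n. char_fun (convolve (\<nu> n) P) z) \<longlonglongrightarrow> char_fun \<mu> z"
    and B': "\<forall>n. (\<integral>\<^sup>+x. ennreal (exp (\<kappa> * norm x)) \<partial>\<nu> n) \<le> ennreal B"
    and fin': "\<forall>g. g \<in> borel_measurable borel \<longrightarrow> (\<forall>x. 0 \<le> g x) \<longrightarrow> g 0 \<le> 1 \<longrightarrow>
       (\<forall>x y. g (x + y) \<le> g x * g y) \<longrightarrow> (\<integral>\<^sup>+x. ennreal (g x) \<partial>large_jumps M) < \<infinity> \<longrightarrow>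
       (\<integral>\<^sup>+x. ennreal (g x) \<partial>P) < \<infinity>"
    and P_ge': "\<forall>f. f \<in> borel_measurable borel \<longrightarrow>
       ennreal (exp (- measure (large_jumps M) UNIV)) * (\<integral>\<^sup>+x. f x \<partial>large_jumps M) \<le> (\<integral>\<^sup>+x. f x \<partial>P)"
    by (elim exE conjE) (rule that)
  from * have \<nu>: "\<And>n. prob_space (\<nu> n)" "\<And>n. sets (\<nu> n) = sets borel" by auto
  note lim = spec[OF lim'] and B = spec[OF B'] and P_ge = spec[OF P_ge', THEN mp]
  have fin: "(\<integral>\<^sup>+x. ennreal (g x) \<partial>P) < \<infinity>" if "(\<integral>\<^sup>+x. ennreal (g x) \<partial>large_jumps M) < \<infinity>"
    using fin' that meas nonneg at_0 submult by simp
  note \<nu>(2)[measurable_cong] P(2)[measurable_cong] sets_jumps(2)[OF levy, measurable_cong]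
  have large: "(\<integral>\<^sup>+x. ennreal (g x) \<partial>large_jumps M) = (\<integral>\<^sup>+x\<in>{x. 1 < norm x}. ennreal (g x) \<partial>M)"
    unfolding large_jumps_def
    by (subst nn_integral_density) (auto simp: mult.commute ennreal_indicator)
  have conv: "prob_space (convolve (\<nu> n) P)" "sets (convolve (\<nu> n) P) = sets borel" for n
    by (auto intro!: prob_space_convolve \<nu> P)
  show ?thesis
  proof
    assume "(\<integral>\<^sup>+x\<in>{x. 1 < norm x}. ennreal (g x) \<partial>M) < \<infinity>"
    then have finP: "(\<integral>\<^sup>+x. ennreal (g x) \<partial>P) < \<infinity>" by (intro fin) (simp add: large)
    have "(\<integral>\<^sup>+x. ennreal (g x) \<partial>convolve (\<nu> n) P) \<le> ennreal C * ennreal B * (\<integral>\<^sup>+x. ennreal (g x) \<partial>P)" for n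
    proof -
      have "(\<integral>\<^sup>+x. ennreal (g x) \<partial>convolve (\<nu> n) P) = (\<integral>\<^sup>+y. \<integral>\<^sup>+x. ennreal (g (y + x)) \<partial>P \<partial>\<nu> n)"
        by (rule nn_integral_convolve[OF \<nu>(1) P(1) \<nu>(2) P(2)]) measurable
      also have "\<dots> \<le> (\<integral>\<^sup>+y. \<integral>\<^sup>+x. (ennreal C * ennreal (exp (\<kappa> * norm y))) * ennreal (g x) \<partial>P \<partial>\<nu> n)"
      proof (intro nn_integral_mono)
        fix x y
        have "ennreal (g (y + x)) \<le> ennreal (g y) * ennreal (g x)" by (rule submult_ennreal)
        also have "\<dots> \<le> (ennreal C * ennreal (exp (\<kappa> * norm y))) * ennreal (g x)"
          using growth[of y] const_pos by (intro mult_right_mono) (auto simp: ennreal_mult[symmetric] ennreal_leI)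
        finally show "ennreal (g (y + x)) \<le> (ennreal C * ennreal (exp (\<kappa> * norm y))) * ennreal (g x)" .
      qed
      also have "\<dots> = ennreal C * (\<integral>\<^sup>+y. ennreal (exp (\<kappa> * norm y)) \<partial>\<nu> n) * (\<integral>\<^sup>+x. ennreal (g x) \<partial>P)"
        by (simp add: nn_integral_cmult nn_integral_multc)
      also have "\<dots> \<le> ennreal C * ennreal B * (\<integral>\<^sup>+x. ennreal (g x) \<partial>P)"
        by (intro mult_right_mono mult_left_mono B) auto
      finally show ?thesis .
    qed
    moreover have "ennreal C * ennreal B * (\<integral>\<^sup>+x. ennreal (g x) \<partial>P) < \<infinity>"
      using finP by (simp add: ennreal_mult_less_top)
    ultimately show "(\<integral>\<^sup>+x. ennreal (g x) \<partial>\<mu>) < \<infinity>"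
      by (rule nn_integral_finite_of_char_fun_limit[OF \<mu> conv lim])
  next
    assume fin\<mu>: "(\<integral>\<^sup>+x. ennreal (g x) \<partial>\<mu>) < \<infinity>"
    \<comment> \<open>\<open>K\<close> is chosen so that Markov's inequality for \<open>exp (\<kappa> * norm x)\<close> leaves mass at most \<open>1 / 2\<close>
       outside the ball of radius \<open>K\<close>; the maximum covers the case \<open>B < 1\<close>.\<close>
    define K where "K = ln (2 * max B 1) / \<kappa>"
    have K: "exp (\<kappa> * K) = 2 * max B 1" "0 \<le> K"
      unfolding K_def using rate_pos by (auto simp: exp_ln)
    have tight: "ennreal (1 / 2) \<le> emeasure (\<nu> n) (cball 0 K)" for n
    proof -
      interpret N: prob_space "\<nu> n" by (rule \<nu>)
      have sp: "space (\<nu> n) = UNIV" using sets_eq_imp_space_eq[OF \<nu>(2)] by simp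
      have "emeasure (\<nu> n) {x. K < norm x} \<le> (\<integral>\<^sup>+x. ennreal (exp (\<kappa> * norm x)) * ennreal (exp (- \<kappa> * K)) \<partial>\<nu> n)"
      proof -
        have "emeasure (\<nu> n) {x. K < norm x} = (\<integral>\<^sup>+x. indicator {x. K < norm x} x \<partial>\<nu> n)"
          by (rule nn_integral_indicator[symmetric]) measurable
        also have "\<dots> \<le> (\<integral>\<^sup>+x. ennreal (exp (\<kappa> * norm x)) * ennreal (exp (- \<kappa> * K)) \<partial>\<nu> n)"
          using rate_pos
          by (intro nn_integral_mono) (auto split: split_indicator simp: ennreal_mult[symmetric] exp_add[symmetric] algebra_simps)
        finally show ?thesis .
      qed
      also have "\<dots> \<le> ennreal B * ennreal (exp (- \<kappa> * K))"
        by (subst nn_integral_multc) (auto intro!: mult_right_mono B)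
      also have "\<dots> \<le> ennreal (max B 1) * ennreal (exp (- \<kappa> * K))"
        by (intro mult_right_mono ennreal_leI) auto
      also have "\<dots> = ennreal (1 / 2)"
        using K(1) by (simp add: ennreal_mult[symmetric] exp_minus field_simps)
      finally have "N.prob {x. K < norm x} \<le> 1 / 2"
        unfolding N.emeasure_eq_measure by (subst (asm) ennreal_le_iff) auto
      moreover have "N.prob (cball 0 K) = 1 - N.prob {x. K < norm x}"
        by (subst N.prob_compl[symmetric]) (auto simp: sp intro!: arg_cong[where f="N.prob"])
      ultimately show ?thesis
        unfolding N.emeasure_eq_measure by (intro ennreal_leI) linarith
    qed
    define D where "D = C * exp (\<kappa> * K)"
    have D: "0 < D" using const_pos by (simp add: D_def)
    let ?c = "ennreal (exp (- measure (large_jumps M) UNIV))"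
    let ?L = "\<lambda>r. \<integral>\<^sup>+x. ennreal (g x) * indicator (cball 0 r) x \<partial>large_jumps M"
    have step: "ennreal (1 / 2) * (ennreal (1 / D) * (?c * ?L r)) \<le> (\<integral>\<^sup>+x\<in>cball 0 (r + K). ennreal (g x) \<partial>convolve (\<nu> n) P)" for r n
    proof -
      have "ennreal (1 / 2) * (ennreal (1 / D) * (?c * ?L r)) \<le>
         emeasure (\<nu> n) (cball 0 K) * (ennreal (1 / D) * (\<integral>\<^sup>+x. ennreal (g x) * indicator (cball 0 r) x \<partial>P))"
        by (intro mult_mono tight P_ge) auto
      also have "\<dots> = (\<integral>\<^sup>+y. \<integral>\<^sup>+x. indicator (cball 0 K) y * (ennreal (1 / D) * (ennreal (g x) * indicator (cball 0 r) x)) \<partial>P \<partial>\<nu> n)"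
        by (simp add: nn_integral_cmult nn_integral_multc)
      also have "\<dots> \<le> (\<integral>\<^sup>+y. \<integral>\<^sup>+x. ennreal (g (y + x)) * indicator (cball 0 (r + K)) (y + x) \<partial>P \<partial>\<nu> n)"
      proof (intro nn_integral_mono)
        fix x y
        show "indicator (cball 0 K) y * (ennreal (1 / D) * (ennreal (g x) * indicator (cball 0 r) x))
          \<le> ennreal (g (y + x)) * indicator (cball 0 (r + K)) (y + x)"
        proof (cases "y \<in> cball 0 K \<and> x \<in> cball 0 r")
          case True
          then have "y + x \<in> cball 0 (r + K)" using norm_triangle_ineq[of y x] by auto
          moreover have "1 / D * g x \<le> g (y + x)"
          proof -
            have "exp (\<kappa> * norm y) \<le> exp (\<kappa> * K)" using True rate_pos by simp
            then have "g y \<le> D"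
              using growth[of y] const_pos unfolding D_def by (meson less_imp_le mult_left_mono order_trans)
            then have "g x \<le> g (x + y) * D"
              using submult_sub[of x y] mult_left_mono[of "g y" D "g (x + y)"] nonneg by (meson order_trans)
            then show ?thesis using D by (simp add: field_simps)
          qed
          ultimately show ?thesis using True D
            by (simp add: ennreal_mult[symmetric] nonneg ennreal_leI)
        qed (auto split: split_indicator)
      qed
      also have "\<dots> = (\<integral>\<^sup>+x\<in>cball 0 (r + K). ennreal (g x) \<partial>convolve (\<nu> n) P)"
        by (rule nn_integral_convolve[OF \<nu>(1) P(1) \<nu>(2) P(2), symmetric]) measurable
      finally show ?thesis .
    qed
    have le: "lower_const * (ennreal (1 / 2) * (ennreal (1 / D) * (?c * ?L r))) \<le> upper_const * (\<integral>\<^sup>+x. ennreal (g x) \<partial>\<mu>)" for r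
      by (rule nn_integral_balls_le_of_char_fun_limit[OF \<mu> conv lim step])
    have "(SUP n. ?L (real n)) = (\<integral>\<^sup>+x. (SUP n. ennreal (g x) * indicator (cball 0 (real n)) x) \<partial>large_jumps M)"
      by (rule nn_integral_monotone_convergence_SUP[symmetric])
        (auto simp: incseq_def le_fun_def split: split_indicator)
    also have "\<dots> = (\<integral>\<^sup>+x. ennreal (g x) \<partial>large_jumps M)"
    proof (intro nn_integral_cong antisym)
      fix x
      show "(SUP n. ennreal (g x) * indicator (cball 0 (real n)) x) \<le> ennreal (g x)"
        by (intro SUP_least) (auto split: split_indicator)
      obtain n where "norm x \<le> real n" using real_arch_simple by blast
      then show "ennreal (g x) \<le> (SUP n. ennreal (g x) * indicator (cball 0 (real n)) x)"
        by (intro SUP_upper2[of n]) auto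
    qed
    finally have "lower_const * (ennreal (1 / 2) * (ennreal (1 / D) * (?c * (\<integral>\<^sup>+x. ennreal (g x) \<partial>large_jumps M)))) =
       (SUP n. lower_const * (ennreal (1 / 2) * (ennreal (1 / D) * (?c * ?L (real n)))))"
      by (simp only: SUP_mult_left_ennreal[symmetric])
    also have "\<dots> \<le> upper_const * (\<integral>\<^sup>+x. ennreal (g x) \<partial>\<mu>)"
      by (intro SUP_least le)
    also have "\<dots> < \<infinity>"
      using upper_const_finite fin\<mu> by (simp add: ennreal_mult_less_top)
    finally have "(\<integral>\<^sup>+x. ennreal (g x) \<partial>large_jumps M) < \<infinity>"
      using lower_const_pos D by (auto simp: ennreal_mult_less_top ennreal_eq_0_iff)
    then show "(\<integral>\<^sup>+x\<in>{x. 1 < norm x}. ennreal (g x) \<partial>M) < \<infinity>"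
      by (simp add: large)
  qed
qed

section \<open>Integrals against the L\'evy measure of a tempered stable law\<close>

lemma nn_integral_TS_levy:
  fixes R :: "'a::euclidean_space measure"
  assumes R: "sets R = sets borel" and f [measurable]: "f \<in> borel_measurable borel"
  shows "(\<integral>\<^sup>+x. f x \<partial>TS_levy p \<alpha> R) =
    (\<integral>\<^sup>+x. (\<integral>\<^sup>+t\<in>{0<..}. f (t *\<^sub>R x) * ennreal (t powr (-1 - \<alpha>) * exp (- (t powr p))) \<partial>lborel) \<partial>R)"
proof -
  note R[measurable_cong]
  define k where "k t = ennreal (t powr (-1 - \<alpha>) * exp (- (t powr p))) * indicator {0<..} t" for t :: real
  have [measurable]: "k \<in> borel_measurable borel" unfolding k_def by measurable
  let ?D = "distr (density (R \<Otimes>\<^sub>M lborel) (\<lambda>(x, t). k t)) borel (\<lambda>(x, t). t *\<^sub>R x)"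
  have D: "(\<integral>\<^sup>+x. h x \<partial>?D) = (\<integral>\<^sup>+x. (\<integral>\<^sup>+t. k t * h (t *\<^sub>R x) \<partial>lborel) \<partial>R)"
    if [measurable]: "h \<in> borel_measurable borel" for h
  proof -
    have "(\<integral>\<^sup>+x. h x \<partial>?D) = (\<integral>\<^sup>+y. k (snd y) * h (snd y *\<^sub>R fst y) \<partial>(R \<Otimes>\<^sub>M lborel))"
      by (simp add: nn_integral_distr nn_integral_density split_beta')
    also have "\<dots> = (\<integral>\<^sup>+x. (\<integral>\<^sup>+t. k t * h (t *\<^sub>R x) \<partial>lborel) \<partial>R)"
      by (subst lborel.nn_integral_fst[symmetric]) auto
    finally show ?thesis .
  qed
  have "TS_levy p \<alpha> R = ?D"
  proof (rule measure_eqI)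
    show "sets (TS_levy p \<alpha> R) = sets ?D" by (simp add: sets_TS_levy)
    fix A assume "A \<in> sets (TS_levy p \<alpha> R)"
    then have A [measurable]: "A \<in> sets borel" by (simp add: sets_TS_levy)
    have "emeasure ?D A = (\<integral>\<^sup>+x. indicator A x \<partial>?D)" by simp
    also have "\<dots> = (\<integral>\<^sup>+x. (\<integral>\<^sup>+t. k t * indicator A (t *\<^sub>R x) \<partial>lborel) \<partial>R)"
      by (rule D) measurable
    finally show "emeasure (TS_levy p \<alpha> R) A = emeasure ?D A"
      unfolding emeasure_TS_levy[OF R A] k_def by (simp add: ac_simps)
  qed
  then show ?thesis
    by (simp only: D[OF f]) (simp add: k_def ac_simps)
qed

text \<open>For \<open>a = 0\<close>, \<open>\<delta> = 1\<close> and \<open>\<beta> > 0\<close> this is \<open>Gamma (\<beta> / p) / p\<close>.  The moment problem leads to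
\<open>\<beta> = - \<alpha>\<close> and \<open>a = 1\<close>.\<close>

definition tail_integral :: "real \<Rightarrow> real \<Rightarrow> real \<Rightarrow> real \<Rightarrow> ennreal" where
  "tail_integral p \<beta> \<delta> a = (\<integral>\<^sup>+u\<in>{a<..}. ennreal (exp (- \<delta> * u powr p) * u powr (\<beta> - 1)) \<partial>lborel)"

text \<open>Substitution \<open>v = \<delta> powr (1 / p) * u\<close>.\<close>

lemma tail_integral_scale:
  assumes p: "0 < p" and \<delta>: "0 < \<delta>" and a: "0 \<le> a"
  shows "tail_integral p \<beta> \<delta> a = ennreal (\<delta> powr (- \<beta> / p)) * tail_integral p \<beta> 1 (a * \<delta> powr (1 / p))"
proof -
  define c where "c = \<delta> powr (- 1 / p)"
  have c: "0 < c" using \<delta> by (simp add: c_def)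
  have ac: "a < c * v \<longleftrightarrow> a * \<delta> powr (1 / p) < v" for v
    using \<delta> by (simp add: c_def powr_minus field_simps)
  have "c powr p = \<delta> powr (- 1 / p * p)" by (simp only: c_def powr_powr)
  then have cp: "\<delta> * c powr p = 1" using p \<delta> by (simp add: powr_minus)
  have cb: "c * c powr (\<beta> - 1) = \<delta> powr (- \<beta> / p)"
  proof -
    have "c * c powr (\<beta> - 1) = c powr \<beta>" using c powr_mult_base[of c "\<beta> - 1"] by simp
    also have "\<dots> = \<delta> powr (- 1 / p * \<beta>)" by (simp only: c_def powr_powr)
    finally show ?thesis by simp
  qed
  have "tail_integral p \<beta> \<delta> a = ennreal \<bar>c\<bar> * (\<integral>\<^sup>+v. ennreal (exp (- \<delta> * (0 + c * v) powr p) * (0 + c * v) powr (\<beta> - 1)) * indicator {a<..} (0 + c * v) \<partial>lborel)"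
    unfolding tail_integral_def using c by (intro nn_integral_real_affine) auto
  also have "\<dots> = (\<integral>\<^sup>+v. ennreal (\<delta> powr (- \<beta> / p)) * (ennreal (exp (- 1 * v powr p) * v powr (\<beta> - 1)) * indicator {a * \<delta> powr (1 / p)<..} v) \<partial>lborel)"
  proof (subst nn_integral_cmult[symmetric], measurable, rule nn_integral_cong)
    fix v :: real
    show "ennreal \<bar>c\<bar> * (ennreal (exp (- \<delta> * (0 + c * v) powr p) * (0 + c * v) powr (\<beta> - 1)) * indicator {a<..} (0 + c * v)) =
      ennreal (\<delta> powr (- \<beta> / p)) * (ennreal (exp (- 1 * v powr p) * v powr (\<beta> - 1)) * indicator {a * \<delta> powr (1 / p)<..} v)"
    proof (cases "a < c * v")
      case True
      then have v: "0 < v" using a c by (smt (verit) zero_less_mult_pos)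
      have "\<delta> * (c * v) powr p = v powr p"
        using c v cp by (simp add: powr_mult mult.assoc[symmetric])
      moreover have "c * (c * v) powr (\<beta> - 1) = \<delta> powr (- \<beta> / p) * v powr (\<beta> - 1)"
        using c v cb by (simp add: powr_mult mult.assoc[symmetric])
      ultimately show ?thesis
        using True ac[of v] c by (simp add: ennreal_mult[symmetric] mult.left_commute)
    qed (use ac[of v] in auto)
  qed
  also have "\<dots> = ennreal (\<delta> powr (- \<beta> / p)) * tail_integral p \<beta> 1 (a * \<delta> powr (1 / p))"
    unfolding tail_integral_def by (rule nn_integral_cmult) measurable
  finally show ?thesis .
qed

lemma tail_integral_antimono: "a \<le> b \<Longrightarrow> tail_integral p \<beta> \<delta> b \<le> tail_integral p \<beta> \<delta> a"
  unfolding tail_integral_def by (intro nn_integral_mono) (auto split: split_indicator)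

lemma tail_integral_mono_exponent:
  assumes "\<beta> \<le> \<gamma>"
  shows "tail_integral p \<beta> \<delta> 1 \<le> tail_integral p \<gamma> \<delta> 1"
  unfolding tail_integral_def using assms
  by (intro nn_integral_mono) (auto split: split_indicator intro!: ennreal_leI powr_mono)

lemma nn_integral_powr_tail:
  assumes "0 < \<alpha>"
  shows "(\<integral>\<^sup>+u\<in>{1<..}. ennreal (u powr (- \<alpha> - 1)) \<partial>lborel) \<le> ennreal (1 / \<alpha>)"
proof -
  have "(\<integral>\<^sup>+u\<in>{1<..}. ennreal (u powr (- \<alpha> - 1)) \<partial>lborel) \<le> (\<integral>\<^sup>+u\<in>{1..}. ennreal (u powr (- \<alpha> - 1)) \<partial>lborel)"
    by (intro nn_integral_mono) (auto split: split_indicator)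
  also have "\<dots> = ennreal (0 - (- (1 powr (- \<alpha>)) / \<alpha>))"
  proof (rule nn_integral_FTC_atLeast)
    show "((\<lambda>u. - (u powr (- \<alpha>)) / \<alpha>) has_real_derivative u powr (- \<alpha> - 1)) (at u)" if "1 \<le> u" for u
      using that assms by (auto intro!: derivative_eq_intros)
    have "((\<lambda>u::real. u powr (- \<alpha>)) \<longlongrightarrow> 0) at_top"
      using assms by (intro tendsto_neg_powr filterlim_ident) auto
    then show "((\<lambda>u. - (u powr (- \<alpha>)) / \<alpha>) \<longlongrightarrow> 0) at_top"
      using tendsto_divide[OF tendsto_minus tendsto_const[of \<alpha>]] assms by fastforce
  qed auto
  finally show ?thesis by simp
qed

lemma nn_integral_powr_near_0:
  assumes "0 < \<beta>"
  shows "(\<integral>\<^sup>+u\<in>{0<..1}. ennreal (u powr (\<beta> - 1)) \<partial>lborel) < \<infinity>"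
proof -
  let ?f = "\<lambda>u::real. if u \<in> {0..1} then u powr (\<beta> - 1) else 0"
  have "((\<lambda>u. u powr (\<beta> - 1)) has_integral (1 powr (\<beta> - 1 + 1) / (\<beta> - 1 + 1))) {0..1::real}"
    using assms by (intro has_integral_powr_from_0) auto
  then have "(?f has_integral (1 / \<beta>)) UNIV"
    by (subst has_integral_restrict_UNIV) simp
  then have "(\<integral>\<^sup>+u. ennreal (?f u) \<partial>lborel) = ennreal (1 / \<beta>)"
    by (intro nn_integral_has_integral_lborel) auto
  moreover have "(\<integral>\<^sup>+u\<in>{0<..1}. ennreal (u powr (\<beta> - 1)) \<partial>lborel) \<le> (\<integral>\<^sup>+u. ennreal (?f u) \<partial>lborel)"
    by (intro nn_integral_mono) (auto split: split_indicator)
  ultimately show ?thesis by (auto intro: le_less_trans)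
qed

lemma nn_integral_inverse_Icc:
  assumes "1 \<le> T"
  shows "(\<integral>\<^sup>+u\<in>{1..T}. ennreal (inverse u) \<partial>lborel) = ennreal (ln T)"
proof -
  have "(\<integral>\<^sup>+u\<in>{1..T}. ennreal (inverse u) \<partial>lborel) = ennreal (ln T - ln 1)"
    using assms by (intro nn_integral_FTC_Icc) (auto intro!: derivative_eq_intros simp: inverse_eq_divide)
  then show ?thesis by simp
qed

lemma nn_integral_inverse_tail: "(\<integral>\<^sup>+u\<in>{1<..}. ennreal (inverse u) \<partial>lborel) = \<infinity>"
proof (rule ccontr)
  assume "(\<integral>\<^sup>+u\<in>{1<..}. ennreal (inverse u) \<partial>lborel) \<noteq> \<infinity>"
  then obtain K where K: "0 \<le> K" "(\<integral>\<^sup>+u\<in>{1<..}. ennreal (inverse u) \<partial>lborel) = ennreal K"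
    by (cases "\<integral>\<^sup>+u\<in>{1<..}. ennreal (inverse u) \<partial>lborel") auto
  have "ennreal (ln (exp (K + 1))) = (\<integral>\<^sup>+u\<in>{1..exp (K + 1)}. ennreal (inverse u) \<partial>lborel)"
    using K(1) by (intro nn_integral_inverse_Icc[symmetric]) auto
  also have "\<dots> \<le> (\<integral>\<^sup>+u\<in>{1<..}. ennreal (inverse u) \<partial>lborel)"
    using AE_lborel_singleton[of "1::real"]
    by (intro nn_integral_mono_AE) (auto elim!: eventually_mono split: split_indicator)
  finally show False using K by simp
qed

lemma power_le_fact_exp: "0 \<le> y \<Longrightarrow> y ^ k \<le> fact k * exp y" for y :: real
proof -
  assume y: "0 \<le> y"
  have "y ^ k / fact k \<le> (\<Sum>n. y ^ n / fact n)"
    using summable_exp_generic[of y] y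
      sum_le_suminf[of "\<lambda>n. y ^ n / fact n" "{k}"] by (simp add: divide_inverse mult.commute scaleR_conv_of_real)
  also have "\<dots> = exp y" by (simp add: exp_def divide_inverse mult.commute)
  finally show ?thesis by (simp add: field_simps)
qed

lemma tail_integral_finite:
  assumes p: "0 < p" and \<beta>: "0 < \<beta>"
  shows "tail_integral p \<beta> 1 0 < \<infinity>"
proof -
  obtain k :: nat where k: "(\<beta> + 1) / p \<le> real k" using real_arch_simple by blast
  then have kp: "\<beta> + 1 \<le> p * real k" using p by (simp add: field_simps)
  have bd: "exp (- 1 * u powr p) * u powr (\<beta> - 1) \<le> fact k * u powr (- 1 - 1)" if u: "1 < u" for u
  proof -
    have "u powr (p * real k) \<le> fact k * exp (u powr p)"
      using power_le_fact_exp[of "u powr p" k] u by (simp add: powr_powr[symmetric] powr_realpow)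
    then have "exp (- 1 * u powr p) \<le> fact k * u powr (- (p * real k))"
      using u by (simp add: exp_minus powr_minus field_simps)
    then have "exp (- 1 * u powr p) * u powr (\<beta> - 1) \<le> fact k * u powr (- (p * real k)) * u powr (\<beta> - 1)"
      by (rule mult_right_mono) simp
    also have "\<dots> = fact k * u powr (\<beta> - 1 - p * real k)"
      by (simp add: powr_add[symmetric] mult.assoc)
    also have "\<dots> \<le> fact k * u powr (- 1 - 1)"
      using u kp by (intro mult_left_mono powr_mono) auto
    finally show ?thesis .
  qed
  have "tail_integral p \<beta> 1 0 \<le> (\<integral>\<^sup>+u. ennreal (u powr (\<beta> - 1)) * indicator {0<..1} u + ennreal (fact k) * (ennreal (u powr (- 1 - 1)) * indicator {1<..} u) \<partial>lborel)"
    unfolding tail_integral_def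
  proof (intro nn_integral_mono)
    fix u :: real
    consider "u \<le> 0" | "0 < u" "u \<le> 1" | "1 < u" by linarith
    then show "ennreal (exp (- 1 * u powr p) * u powr (\<beta> - 1)) * indicator {0<..} u \<le>
       ennreal (u powr (\<beta> - 1)) * indicator {0<..1} u + ennreal (fact k) * (ennreal (u powr (- 1 - 1)) * indicator {1<..} u)"
    proof cases
      case 2
      then show ?thesis by (auto intro!: ennreal_leI mult_left_le_one_le)
    next
      case 3
      then show ?thesis using bd[OF 3] by (auto simp: ennreal_mult[symmetric] intro!: ennreal_leI)
    qed auto
  qed
  also have "\<dots> = (\<integral>\<^sup>+u\<in>{0<..1}. ennreal (u powr (\<beta> - 1)) \<partial>lborel) + ennreal (fact k) * (\<integral>\<^sup>+u\<in>{1<..}. ennreal (u powr (- 1 - 1)) \<partial>lborel)"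
    by (subst nn_integral_add) (auto simp: nn_integral_cmult)
  also have "\<dots> < \<infinity>"
    using nn_integral_powr_near_0[OF \<beta>] le_less_trans[OF nn_integral_powr_tail[of 1]]
    by (simp add: ennreal_mult_less_top)
  finally show ?thesis .
qed

text \<open>In both cases the integrand dominates a multiple of \<open>1 / u\<close>: for \<open>\<delta> < 0\<close> because the
exponential beats any power, for \<open>\<delta> = 0\<close> because the power is then at least \<open>- 1\<close>.\<close>

lemma tail_integral_infinite:
  assumes p: "0 < p" and "\<delta> < 0 \<or> \<delta> \<le> 0 \<and> 0 \<le> \<beta>"
  shows "tail_integral p \<beta> \<delta> 1 = \<infinity>"
proof -
  have "\<exists>c>0. \<forall>u>1. c * inverse u \<le> exp (- \<delta> * u powr p) * u powr (\<beta> - 1)"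
  proof (cases "\<delta> < 0")
    case True
    obtain k :: nat where k: "- \<beta> / p \<le> real k" using real_arch_simple by blast
    then have kp: "0 \<le> p * real k + \<beta>" using p by (simp add: field_simps)
    define c where "c = (- \<delta>) ^ k / fact k"
    have "c * inverse u \<le> exp (- \<delta> * u powr p) * u powr (\<beta> - 1)" if u: "1 < u" for u
    proof -
      have "(- \<delta> * u powr p) ^ k \<le> fact k * exp (- \<delta> * u powr p)"
        using True by (intro power_le_fact_exp) (auto simp: mult_nonpos_nonneg)
      moreover have "(- \<delta> * u powr p) ^ k = (- \<delta>) ^ k * u powr (p * real k)"
        using u by (simp only: power_mult_distrib powr_powr[symmetric] powr_realpow[symmetric] powr_gt_zero)
      ultimately have 1: "c * u powr (p * real k) \<le> exp (- \<delta> * u powr p)"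
        unfolding c_def by (simp add: field_simps)
      have "c * inverse u = c * u powr (- 1)" using u by (simp add: powr_minus)
      also have "\<dots> \<le> c * u powr (p * real k + (\<beta> - 1))"
        unfolding c_def using u kp True by (intro mult_left_mono powr_mono) auto
      also have "\<dots> = c * u powr (p * real k) * u powr (\<beta> - 1)"
        by (simp add: powr_add)
      also have "\<dots> \<le> exp (- \<delta> * u powr p) * u powr (\<beta> - 1)"
        by (rule mult_right_mono[OF 1]) simp
      finally show ?thesis .
    qed
    moreover have "0 < c" unfolding c_def using True by simp
    ultimately show ?thesis by blast
  next
    case False
    then have "\<delta> = 0" "0 \<le> \<beta>" using assms by auto
    moreover have "1 * inverse u \<le> u powr (\<beta> - 1)" if "1 < u" "0 \<le> \<beta>" for u :: real
      using powr_mono[of "- 1" "\<beta> - 1" u] that by (simp add: powr_minus)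
    ultimately show ?thesis by (intro exI[of _ 1]) auto
  qed
  then obtain c where c: "0 < c" "\<And>u. 1 < u \<Longrightarrow> c * inverse u \<le> exp (- \<delta> * u powr p) * u powr (\<beta> - 1)"
    by blast
  have "ennreal c * (\<integral>\<^sup>+u\<in>{1<..}. ennreal (inverse u) \<partial>lborel) = (\<integral>\<^sup>+u. ennreal c * (ennreal (inverse u) * indicator {1<..} u) \<partial>lborel)"
    by (rule nn_integral_cmult[symmetric]) measurable
  also have "\<dots> \<le> tail_integral p \<beta> \<delta> 1"
    unfolding tail_integral_def using c
    by (intro nn_integral_mono) (auto split: split_indicator simp: ennreal_mult[symmetric] intro!: ennreal_leI)
  finally show ?thesis
    using c(1) by (simp add: nn_integral_inverse_tail ennreal_mult_top top_unique ennreal_eq_0_iff)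
qed

lemma tail_integral_pos: "tail_integral p \<beta> 1 1 \<noteq> 0"
proof
  assume "tail_integral p \<beta> 1 1 = 0"
  then have "AE u in lborel. ennreal (exp (- 1 * u powr p) * u powr (\<beta> - 1)) * indicator {1<..} u = 0"
    unfolding tail_integral_def by (subst (asm) nn_integral_0_iff_AE) auto
  then have "AE u in lborel. u \<notin> {1..2::real}"
    using AE_lborel_singleton[of "1::real"]
    by eventually_elim (auto simp: ennreal_eq_0_iff mult_le_0_iff split: split_indicator_asm)
  then have "emeasure lborel {1..2::real} = 0"
    by (subst (asm) AE_iff_measurable[of "{1..2}"]) auto
  then show False by simp
qed


lemma tail_integral_measurable [measurable]:
  "(\<lambda>\<delta>. tail_integral p \<beta> \<delta> a) \<in> borel_measurable borel"
  unfolding tail_integral_def by measurable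

text \<open>Substitution \<open>u = t * norm x\<close>; the restriction to jumps of size greater than one becomes \<open>u > 1\<close>,
and weight and tempering combine to \<open>exp (- (norm x powr (- p) - \<theta>) * u powr p)\<close>.\<close>

lemma jump_integral_along_ray:
  fixes x :: "'a::euclidean_space"
  assumes p: "0 < p"
  shows "(\<integral>\<^sup>+t\<in>{0<..}. (ennreal (exp (\<theta> * norm (t *\<^sub>R x) powr p)) * indicator {x. 1 < norm x} (t *\<^sub>R x)) *
      ennreal (t powr (-1 - \<alpha>) * exp (- (t powr p))) \<partial>lborel) =
    ennreal (norm x powr \<alpha>) * tail_integral p (- \<alpha>) (norm x powr (- p) - \<theta>) 1" (is "?I = _")
proof (cases "x = 0")
  case True
  then show ?thesis by simp
next
  case False
  define n where "n = norm x"
  have n: "0 < n" using False by (simp add: n_def)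
  let ?f = "\<lambda>t. (ennreal (exp (\<theta> * norm (t *\<^sub>R x) powr p)) * indicator {x. 1 < norm x} (t *\<^sub>R x)) *
      ennreal (t powr (-1 - \<alpha>) * exp (- (t powr p))) * indicator {0<..} t"
  have "?I = ennreal \<bar>1 / n\<bar> * (\<integral>\<^sup>+u. ?f (0 + (1 / n) * u) \<partial>lborel)"
    using n by (intro nn_integral_real_affine) auto
  also have "\<dots> = (\<integral>\<^sup>+u. ennreal \<bar>1 / n\<bar> * ?f (0 + (1 / n) * u) \<partial>lborel)"
    by (rule nn_integral_cmult[symmetric]) measurable
  also have "\<dots> = (\<integral>\<^sup>+u. ennreal (n powr \<alpha>) * (ennreal (exp (- (n powr (- p) - \<theta>) * u powr p) * u powr (- \<alpha> - 1)) * indicator {1<..} u) \<partial>lborel)"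
  proof (rule nn_integral_cong)
    fix u :: real
    show "ennreal \<bar>1 / n\<bar> * ?f (0 + (1 / n) * u) =
      ennreal (n powr \<alpha>) * (ennreal (exp (- (n powr (- p) - \<theta>) * u powr p) * u powr (- \<alpha> - 1)) * indicator {1<..} u)"
    proof (cases "1 < u")
      case True
      have nm: "norm ((u / n) *\<^sub>R x) = u" using True n by (simp add: n_def)
      have "(u / n) powr p = n powr (- p) * u powr p"
        using True n powr_divide[of u n p] by (simp add: powr_minus divide_inverse mult.commute)
      then have e: "exp (\<theta> * u powr p) * exp (- ((u / n) powr p)) = exp (- (n powr (- p) - \<theta>) * u powr p)"
        by (simp add: exp_add[symmetric] algebra_simps)
      have "(u / n) powr (- 1 - \<alpha>) = n powr (1 + \<alpha>) * u powr (- \<alpha> - 1)"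
        using True n powr_minus[of n "1 + \<alpha>"] powr_divide[of u n "- 1 - \<alpha>"]
        by (simp add: powr_divide divide_inverse minus_diff_commute[of _ "1::real"] add.commute)
      moreover have "1 / n * n powr (1 + \<alpha>) = n powr \<alpha>"
        using n by (simp add: powr_add)
      ultimately have w: "1 / n * (u / n) powr (- 1 - \<alpha>) = n powr \<alpha> * u powr (- \<alpha> - 1)"
        by (simp add: mult.assoc[symmetric])
      have "ennreal \<bar>1 / n\<bar> * ?f (0 + (1 / n) * u) =
         ennreal (1 / n * (exp (\<theta> * u powr p) * ((u / n) powr (- 1 - \<alpha>) * exp (- ((u / n) powr p)))))"
        using True n nm by (simp add: ennreal_mult[symmetric])
      also have "1 / n * (exp (\<theta> * u powr p) * ((u / n) powr (- 1 - \<alpha>) * exp (- ((u / n) powr p))))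
         = (1 / n * (u / n) powr (- 1 - \<alpha>)) * (exp (\<theta> * u powr p) * exp (- ((u / n) powr p)))"
        by (simp only: ac_simps)
      also have "\<dots> = n powr \<alpha> * (exp (- (n powr (- p) - \<theta>) * u powr p) * u powr (- \<alpha> - 1))"
        unfolding w e by (simp only: ac_simps)
      finally show ?thesis using True by (simp add: ennreal_mult)
    next
      case False
      then show ?thesis using n by (auto simp: n_def[symmetric] zero_less_divide_iff split: split_indicator)
    qed
  qed
  also have "\<dots> = ennreal (n powr \<alpha>) * tail_integral p (- \<alpha>) (n powr (- p) - \<theta>) 1"
    unfolding tail_integral_def by (rule nn_integral_cmult) measurable
  finally show ?thesis by (simp add: n_def)
qed

text \<open>The three integrability conditions on a Rosinski measure differ only at infinity.\<close>

lemma rosinski_measure_local_square: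
  fixes R :: "'a::euclidean_space measure"
  assumes R: "rosinski_measure \<alpha> R" and \<alpha>: "\<alpha> < 2" and r: "0 < r"
  shows "(\<integral>\<^sup>+x\<in>{x. norm x \<le> r}. ennreal ((norm x)\<^sup>2) \<partial>R) < \<infinity>"
proof -
  have sets: "sets R = sets borel" using R by (simp add: rosinski_measure_def)
  note sets[measurable_cong]
  have gen: ?thesis
    if [measurable]: "w \<in> borel_measurable borel" and fin: "(\<integral>\<^sup>+x. ennreal (min ((norm x)\<^sup>2) (w x)) \<partial>R) < \<infinity>"
      and K: "1 \<le> K" and w: "\<And>x. norm x \<le> r \<Longrightarrow> (norm x)\<^sup>2 \<le> K * w x" for w :: "'a \<Rightarrow> real" and K
  proof -
    have "(\<integral>\<^sup>+x\<in>{x. norm x \<le> r}. ennreal ((norm x)\<^sup>2) \<partial>R) \<le> (\<integral>\<^sup>+x. ennreal K * ennreal (min ((norm x)\<^sup>2) (w x)) \<partial>R)"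
    proof (intro nn_integral_mono)
      fix x
      have "(norm x)\<^sup>2 \<le> K * min ((norm x)\<^sup>2) (w x)" if "norm x \<le> r"
        using w[OF that] K mult_right_mono[OF K, of "(norm x)\<^sup>2"] by (simp add: min_def)
      then show "ennreal ((norm x)\<^sup>2) * indicator {x. norm x \<le> r} x \<le> ennreal K * ennreal (min ((norm x)\<^sup>2) (w x))"
        using K by (auto split: split_indicator simp: ennreal_mult'[symmetric] intro!: ennreal_leI)
    qed
    also have "\<dots> = ennreal K * (\<integral>\<^sup>+x. ennreal (min ((norm x)\<^sup>2) (w x)) \<partial>R)"
      by (rule nn_integral_cmult) measurable
    also have "\<dots> < \<infinity>" using fin by (simp add: ennreal_mult_less_top)
    finally show ?thesis .
  qed
  have sq: "(norm x)\<^sup>2 \<le> max 1 (r\<^sup>2)" if "norm x \<le> r" for x :: 'a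
    using power_mono[OF that norm_ge_zero, of 2] by simp
  consider "0 < \<alpha>" | "\<alpha> = 0" | "\<alpha> < 0" by linarith
  then show ?thesis
  proof cases
    case 1
    show ?thesis
    proof (rule gen[of "\<lambda>x. norm x powr \<alpha>" "max 1 (r powr (2 - \<alpha>))"])
      fix x :: 'a assume x: "norm x \<le> r"
      show "(norm x)\<^sup>2 \<le> max 1 (r powr (2 - \<alpha>)) * norm x powr \<alpha>"
      proof (cases "x = 0")
        case False
        then have "(norm x)\<^sup>2 = norm x powr (2 - \<alpha>) * norm x powr \<alpha>"
          by (simp add: powr_add[symmetric] powr_numeral)
        also have "\<dots> \<le> max 1 (r powr (2 - \<alpha>)) * norm x powr \<alpha>"
          using x \<alpha> by (intro mult_right_mono) (auto intro!: max.coboundedI2 powr_mono2)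
        finally show ?thesis .
      qed simp
    qed (use R 1 in \<open>auto simp: rosinski_measure_def\<close>)
  next
    case 2
    show ?thesis
    proof (rule gen[of "\<lambda>x. 1 + max 0 (ln (norm x))" "max 1 (r\<^sup>2)"])
      fix x :: 'a assume "norm x \<le> r"
      then have "(norm x)\<^sup>2 \<le> max 1 (r\<^sup>2) * 1" using sq by simp
      also have "\<dots> \<le> max 1 (r\<^sup>2) * (1 + max 0 (ln (norm x)))"
        by (rule mult_left_mono) auto
      finally show "(norm x)\<^sup>2 \<le> max 1 (r\<^sup>2) * (1 + max 0 (ln (norm x)))" .
    qed (use R 2 in \<open>auto simp: rosinski_measure_def\<close>)
  next
    case 3
    show ?thesis
      by (rule gen[of "\<lambda>x. 1" "max 1 (r\<^sup>2)"]) (use R 3 sq in \<open>auto simp: rosinski_measure_def\<close>)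
  qed
qed

lemma powr_between_endpoints:
  fixes y \<theta> e :: real
  assumes "0 < \<theta>" "\<theta> \<le> y" "y \<le> \<theta> + 1"
  shows "min (\<theta> powr e) ((\<theta> + 1) powr e) \<le> y powr e" "y powr e \<le> max (\<theta> powr e) ((\<theta> + 1) powr e)"
proof -
  have "\<theta> powr e \<le> y powr e \<and> y powr e \<le> (\<theta> + 1) powr e" if "0 \<le> e"
    using that assms by (auto intro!: powr_mono2)
  moreover have "(\<theta> + 1) powr e \<le> y powr e \<and> y powr e \<le> \<theta> powr e" if "e \<le> 0"
    using that assms by (auto intro!: powr_mono2')
  ultimately show "min (\<theta> powr e) ((\<theta> + 1) powr e) \<le> y powr e" "y powr e \<le> max (\<theta> powr e) ((\<theta> + 1) powr e)"
    by (smt (verit))+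
qed

lemma powr_neg_less_iff:
  fixes p n \<theta> :: real
  assumes "0 < p" "0 < n" "0 < \<theta>"
  shows "n powr (- p) < \<theta> \<longleftrightarrow> \<theta> powr (- 1 / p) < n" and "n powr (- p) \<le> \<theta> \<longleftrightarrow> \<theta> powr (- 1 / p) \<le> n"
proof -
  have m: "ln (n powr (- p)) = - p * ln n" "ln (\<theta> powr (- 1 / p)) = - ln \<theta> / p"
    by simp_all
  have "n powr (- p) < \<theta> \<longleftrightarrow> - p * ln n < ln \<theta>"
    using assms m by (metis ln_less_cancel_iff powr_gt_zero less_irrefl)
  also have "\<dots> \<longleftrightarrow> - ln \<theta> / p < ln n"
    using assms by (auto simp: field_simps)
  also have "\<dots> \<longleftrightarrow> \<theta> powr (- 1 / p) < n"
    using assms m by (metis ln_less_cancel_iff powr_gt_zero less_irrefl)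
  finally show "n powr (- p) < \<theta> \<longleftrightarrow> \<theta> powr (- 1 / p) < n" .
  have "n powr (- p) \<le> \<theta> \<longleftrightarrow> - p * ln n \<le> ln \<theta>"
    using assms m by (metis ln_le_cancel_iff powr_gt_zero less_irrefl)
  also have "\<dots> \<longleftrightarrow> - ln \<theta> / p \<le> ln n"
    using assms by (auto simp: field_simps)
  also have "\<dots> \<longleftrightarrow> \<theta> powr (- 1 / p) \<le> n"
    using assms m by (metis ln_le_cancel_iff powr_gt_zero less_irrefl)
  finally show "n powr (- p) \<le> \<theta> \<longleftrightarrow> \<theta> powr (- 1 / p) \<le> n" .
qed

section \<open>Behaviour near the critical radius\<close>

text \<open>The common part of the three cases.  Write \<open>\<delta> x = norm x powr (- p) - \<theta>\<close>.  Where \<open>\<delta> x \<in> Z\<close> the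
integrand is infinite, so that region must be null.  Where \<open>\<delta> x < 1\<close> the norm is bounded away from
zero and, if also \<open>\<delta> x \<ge> 0\<close>, bounded above; there the integrand is comparable with \<open>h (\<delta> x)\<close> up to
additive constants, and these integrate to something finite because \<open>R\<close> is finite on that annulus.
Where \<open>\<delta> x \<ge> 1\<close> the integrand is at most a constant times \<open>(norm x)\<^sup>2\<close>.\<close>

lemma tempered_moment_criterion:
  fixes R :: "'a::euclidean_space measure" and \<alpha> p \<theta> a b c :: real and h :: "real \<Rightarrow> real" and Z :: "real set"
  assumes \<alpha>: "\<alpha> < 2" and p: "0 < p" and \<theta>: "0 < \<theta>" and R: "rosinski_measure \<alpha> R"
    and h [measurable]: "h \<in> borel_measurable borel" and Z [measurable]: "Z \<in> sets borel"
    and a: "0 \<le> a" and b: "0 \<le> b" and c: "0 < c"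
    and inf: "\<And>\<delta>. \<delta> \<in> Z \<Longrightarrow> tail_integral p (- \<alpha>) \<delta> 1 = \<infinity>"
    and Z_neg: "\<And>\<delta>. \<delta> < 0 \<Longrightarrow> \<delta> \<in> Z"
    and upper: "\<And>\<delta>. \<delta> \<notin> Z \<Longrightarrow> \<delta> < 1 \<Longrightarrow> tail_integral p (- \<alpha>) \<delta> 1 \<le> ennreal a + ennreal b * ennreal (h \<delta>) * indicator {0<..} \<delta>"
    and lower: "\<And>\<delta>. 0 < \<delta> \<Longrightarrow> \<delta> < 1 \<Longrightarrow> ennreal c * ennreal (h \<delta>) \<le> tail_integral p (- \<alpha>) \<delta> 1"
  shows "(\<integral>\<^sup>+x. ennreal (norm x powr \<alpha>) * tail_integral p (- \<alpha>) (norm x powr (- p) - \<theta>) 1 \<partial>R) < \<infinity> \<longleftrightarrow>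
    emeasure R {x. x \<noteq> 0 \<and> norm x powr (- p) - \<theta> \<in> Z} = 0 \<and>
    (\<integral>\<^sup>+x\<in>{x. 0 < norm x powr (- p) - \<theta> \<and> norm x powr (- p) - \<theta> < 1}.
       ennreal (h (norm x powr (- p) - \<theta>)) \<partial>R) < \<infinity>"
proof -
  have sets: "sets R = sets borel" using R by (simp add: rosinski_measure_def)
  have sp: "space R = UNIV" using sets_eq_imp_space_eq[OF sets] by simp
  note sets[measurable_cong]
  define \<delta> where "\<delta> x = norm x powr (- p) - \<theta>" for x :: 'a
  have [measurable]: "\<delta> \<in> borel_measurable borel" unfolding \<delta>_def by measurable
  define F where "F x = ennreal (norm x powr \<alpha>) * tail_integral p (- \<alpha>) (\<delta> x) 1" for x :: 'a
  have [measurable]: "F \<in> borel_measurable borel" unfolding F_def by measurable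
  define B where "B = {x. 0 < \<delta> x \<and> \<delta> x < 1}"
  have [measurable]: "B \<in> sets borel" unfolding B_def by measurable
  have "{x. x \<noteq> 0 \<and> \<delta> x \<in> Z} = - {0} \<inter> (\<delta> -` Z \<inter> space borel)" by auto
  also have "\<dots> \<in> sets borel" by measurable
  finally have N [measurable]: "{x. x \<noteq> 0 \<and> \<delta> x \<in> Z} \<in> sets borel" .
  have AE0: "AE x in R. x \<noteq> 0"
    using R by (intro AE_I'[of "{0}"]) (auto simp: null_sets_def rosinski_measure_def)
  define c1 where "c1 = min (\<theta> powr (- \<alpha> / p)) ((\<theta> + 1) powr (- \<alpha> / p))"
  define c2 where "c2 = max (\<theta> powr (- \<alpha> / p)) ((\<theta> + 1) powr (- \<alpha> / p))"
  define c3 where "c3 = (\<theta> + 1) powr (2 / p)"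
  have c123: "0 < c1" "0 < c2" "0 < c3"
    unfolding c1_def c2_def c3_def using \<theta> by (auto simp: less_max_iff_disj)
  have nrm: "norm x powr e = (\<delta> x + \<theta>) powr (- e / p)" if "x \<noteq> 0" for x e
    using that p by (simp add: \<delta>_def powr_powr)
  have near: "c1 \<le> norm x powr \<alpha>" "norm x powr \<alpha> \<le> c2" "1 \<le> c3 * (norm x)\<^sup>2"
    if "x \<noteq> 0" "0 \<le> \<delta> x" "\<delta> x < 1" for x
  proof -
    show "c1 \<le> norm x powr \<alpha>" "norm x powr \<alpha> \<le> c2"
      unfolding nrm[OF that(1)] c1_def c2_def using that \<theta> by (intro powr_between_endpoints; simp)+
    have "(norm x)\<^sup>2 = norm x powr 2" using that by (simp add: powr_numeral)
    also have "\<dots> \<ge> (\<theta> + 1) powr (- 2 / p)"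
      unfolding nrm[OF that(1)] using that \<theta> p by (intro powr_mono2') auto
    finally have "c3 * (\<theta> + 1) powr (- 2 / p) \<le> c3 * (norm x)\<^sup>2"
      using c123 by (intro mult_left_mono) auto
    moreover have "c3 * (\<theta> + 1) powr (- 2 / p) = 1"
      unfolding c3_def using \<theta> by (simp add: powr_add[symmetric])
    ultimately show "1 \<le> c3 * (norm x)\<^sup>2" by simp
  qed
  define \<rho> where "\<rho> = \<theta> powr (- 1 / p)"
  have \<rho>: "0 < \<rho>" using \<theta> by (simp add: \<rho>_def)
  have inside: "norm x \<le> \<rho>" if "x \<noteq> 0" "0 \<le> \<delta> x" for x
    using powr_neg_less_iff(1)[OF p _ \<theta>, of "norm x"] that by (auto simp: \<rho>_def \<delta>_def)
  let ?sq = "\<lambda>x. ennreal ((norm x)\<^sup>2) * indicator {x. norm x \<le> \<rho>} x"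
  obtain G where G: "tail_integral p (2 - \<alpha>) 1 0 = ennreal G" "0 \<le> G"
    using tail_integral_finite[OF p, of "2 - \<alpha>"] \<alpha> by (cases "tail_integral p (2 - \<alpha>) 1 0") auto
  define c4 where "c4 = (\<theta> + 1) powr ((2 - \<alpha>) / p) * G"
  have c4: "0 \<le> c4" unfolding c4_def using G by simp
  \<comment> \<open>Raising the exponent from \<open>- \<alpha>\<close> to \<open>2 - \<alpha> > 0\<close> makes the scaling law applicable at lower limit
     \<open>0\<close> and produces \<open>\<delta> x powr (- (2 - \<alpha>) / p)\<close>, comparable with \<open>norm x powr (2 - \<alpha>)\<close>.\<close>
  have far: "F x \<le> ennreal c4 * ?sq x" if x: "x \<noteq> 0" and d: "1 \<le> \<delta> x" for x
  proof -
    have "tail_integral p (- \<alpha>) (\<delta> x) 1 \<le> tail_integral p (2 - \<alpha>) (\<delta> x) 1"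
      by (rule tail_integral_mono_exponent) simp
    also have "\<dots> \<le> tail_integral p (2 - \<alpha>) (\<delta> x) 0"
      by (rule tail_integral_antimono) simp
    also have "\<dots> = ennreal (\<delta> x powr (- (2 - \<alpha>) / p)) * ennreal G"
      using d G by (subst tail_integral_scale[OF p]) auto
    also have "\<dots> = ennreal (\<delta> x powr (- (2 - \<alpha>) / p) * G)"
      using G by (simp add: ennreal_mult)
    finally have "F x \<le> ennreal (norm x powr \<alpha>) * ennreal (\<delta> x powr (- (2 - \<alpha>) / p) * G)"
      unfolding F_def by (rule mult_left_mono) simp
    also have "\<dots> = ennreal (norm x powr \<alpha> * (\<delta> x powr (- (2 - \<alpha>) / p) * G))"
      using G by (simp add: ennreal_mult)
    also have "\<dots> \<le> ennreal (c4 * (norm x)\<^sup>2)"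
    proof (rule ennreal_leI)
      have "\<theta> * 1 \<le> \<theta> * \<delta> x" using \<theta> d by (intro mult_left_mono) auto
      then have "\<delta> x + \<theta> \<le> (\<theta> + 1) * \<delta> x" by (simp add: algebra_simps)
      then have "((\<theta> + 1) * \<delta> x) powr (- (2 - \<alpha>) / p) \<le> (\<delta> x + \<theta>) powr (- (2 - \<alpha>) / p)"
        using d \<theta> p \<alpha> by (intro powr_mono2') (auto simp: divide_nonpos_pos)
      also have "(\<delta> x + \<theta>) powr (- (2 - \<alpha>) / p) = norm x powr (2 - \<alpha>)"
        by (rule nrm[OF x, symmetric])
      finally have "\<delta> x powr (- (2 - \<alpha>) / p) * (\<theta> + 1) powr (- (2 - \<alpha>) / p) \<le> norm x powr (2 - \<alpha>)"
        using d \<theta> by (simp add: powr_mult mult.commute)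
      then have "\<delta> x powr (- (2 - \<alpha>) / p) \<le> norm x powr (2 - \<alpha>) * (\<theta> + 1) powr ((2 - \<alpha>) / p)"
      proof -
        have "(\<theta> + 1) powr (- (2 - \<alpha>) / p) = inverse ((\<theta> + 1) powr ((2 - \<alpha>) / p))"
          by (simp only: powr_minus[symmetric] minus_divide_left)
        then show ?thesis
          using \<open>_ \<le> norm x powr (2 - \<alpha>)\<close> \<theta> by (simp only: divide_inverse[symmetric]) (simp add: pos_divide_le_eq)
      qed
      then have "norm x powr \<alpha> * (\<delta> x powr (- (2 - \<alpha>) / p) * G) \<le>
          norm x powr \<alpha> * (norm x powr (2 - \<alpha>) * (\<theta> + 1) powr ((2 - \<alpha>) / p) * G)"
        using G by (intro mult_left_mono mult_right_mono) auto
      also have "\<dots> = c4 * (norm x powr \<alpha> * norm x powr (2 - \<alpha>))"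
        by (simp add: c4_def ac_simps)
      also have "norm x powr \<alpha> * norm x powr (2 - \<alpha>) = (norm x)\<^sup>2"
        using x by (simp add: powr_add[symmetric] powr_numeral)
      finally show "norm x powr \<alpha> * (\<delta> x powr (- (2 - \<alpha>) / p) * G) \<le> c4 * (norm x)\<^sup>2" .
    qed
    also have "\<dots> = ennreal c4 * ?sq x"
      using inside[OF x] d c4 by (simp add: ennreal_mult)
    finally show ?thesis .
  qed
  have mid: "F x \<le> ennreal (c2 * a * c3) * ?sq x + ennreal (c2 * b) * (ennreal (h (\<delta> x)) * indicator B x)"
    if x: "x \<noteq> 0" and d: "\<delta> x \<notin> Z" "\<delta> x < 1" for x
  proof -
    have d0: "0 \<le> \<delta> x" using Z_neg d by (meson not_less)
    have ind: "indicator {0<..} (\<delta> x) = (indicator B x :: ennreal)"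
      using d by (auto simp: B_def split: split_indicator)
    have "F x \<le> ennreal c2 * (ennreal a + ennreal b * ennreal (h (\<delta> x)) * indicator {0<..} (\<delta> x))"
      unfolding F_def using near[OF x d0 d(2)] upper[OF d] by (intro mult_mono ennreal_leI) auto
    also have "\<dots> = ennreal (c2 * a) + ennreal (c2 * b) * (ennreal (h (\<delta> x)) * indicator B x)"
      unfolding ind using c123 a b by (simp add: distrib_left ennreal_mult ac_simps)
    also have "ennreal (c2 * a) \<le> ennreal (c2 * a * c3) * ?sq x"
    proof -
      have "c2 * a * 1 \<le> c2 * a * (c3 * (norm x)\<^sup>2)"
        using near(3)[OF x d0 d(2)] c123 a by (intro mult_left_mono) auto
      then show ?thesis
        using inside[OF x d0] c123 a by (simp add: ennreal_mult[symmetric] mult.assoc ennreal_leI)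
    qed
    finally show ?thesis by (simp add: add_right_mono)
  qed
  have sq_fin: "(\<integral>\<^sup>+x. ?sq x \<partial>R) < \<infinity>" by (rule rosinski_measure_local_square[OF R \<alpha> \<rho>])
  have "(\<integral>\<^sup>+x. F x \<partial>R) < \<infinity> \<longleftrightarrow> emeasure R {x. x \<noteq> 0 \<and> \<delta> x \<in> Z} = 0 \<and>
    (\<integral>\<^sup>+x. ennreal (h (\<delta> x)) * indicator B x \<partial>R) < \<infinity>"
  proof
    assume fin: "(\<integral>\<^sup>+x. F x \<partial>R) < \<infinity>"
    then have "AE x in R. F x \<noteq> \<infinity>"
      by (intro nn_integral_noteq_infinite) auto
    then have "AE x in R. x \<notin> {x. x \<noteq> 0 \<and> \<delta> x \<in> Z}"
    proof eventually_elim
      case (elim x)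
      then show ?case by (auto simp: F_def inf ennreal_mult_top)
    qed
    then have "emeasure R {x. x \<noteq> 0 \<and> \<delta> x \<in> Z} = 0"
      by (subst (asm) AE_iff_measurable[of "{x. x \<noteq> 0 \<and> \<delta> x \<in> Z}"]) (auto simp: sp sets intro: N)
    moreover have "ennreal (c1 * c) * (\<integral>\<^sup>+x. ennreal (h (\<delta> x)) * indicator B x \<partial>R) \<le> (\<integral>\<^sup>+x. F x \<partial>R)"
    proof (subst nn_integral_cmult[symmetric], measurable, rule nn_integral_mono_AE)
      show "AE x in R. ennreal (c1 * c) * (ennreal (h (\<delta> x)) * indicator B x) \<le> F x"
        using AE0
      proof eventually_elim
        case (elim x)
        show ?case
        proof (cases "x \<in> B")
          case True
          then have "ennreal c1 * (ennreal c * ennreal (h (\<delta> x))) \<le> F x"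
            unfolding F_def using near[OF elim] lower by (intro mult_mono ennreal_leI) (auto simp: B_def)
          then show ?thesis using True c123 c by (simp add: ennreal_mult ac_simps)
        qed simp
      qed
    qed
    then have "ennreal (c1 * c) * (\<integral>\<^sup>+x. ennreal (h (\<delta> x)) * indicator B x \<partial>R) < \<infinity>"
      using fin by (rule le_less_trans)
    then have "(\<integral>\<^sup>+x. ennreal (h (\<delta> x)) * indicator B x \<partial>R) < \<infinity>"
      using c123 c by (auto simp: ennreal_mult_less_top ennreal_eq_0_iff mult_le_0_iff)
    ultimately show "emeasure R {x. x \<noteq> 0 \<and> \<delta> x \<in> Z} = 0 \<and>
      (\<integral>\<^sup>+x. ennreal (h (\<delta> x)) * indicator B x \<partial>R) < \<infinity>" by simp
  next
    assume asm: "emeasure R {x. x \<noteq> 0 \<and> \<delta> x \<in> Z} = 0 \<and>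
      (\<integral>\<^sup>+x. ennreal (h (\<delta> x)) * indicator B x \<partial>R) < \<infinity>"
    then have "AE x in R. x \<notin> {x. x \<noteq> 0 \<and> \<delta> x \<in> Z}"
      by (intro AE_not_in) (auto simp: null_sets_def sets intro: N)
    with AE0 have "AE x in R. F x \<le> ennreal (c4 + c2 * a * c3) * ?sq x + ennreal (c2 * b) * (ennreal (h (\<delta> x)) * indicator B x)"
    proof eventually_elim
      case (elim x)
      have e: "ennreal (c4 + c2 * a * c3) * ?sq x = ennreal c4 * ?sq x + ennreal (c2 * a * c3) * ?sq x"
        using c4 c123 a by (simp add: distrib_right)
      show ?case
      proof (cases "\<delta> x < 1")
        case True
        have "F x \<le> ennreal (c2 * a * c3) * ?sq x + ennreal (c2 * b) * (ennreal (h (\<delta> x)) * indicator B x)"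
          using elim True by (intro mid) auto
        also have "\<dots> \<le> ennreal (c4 + c2 * a * c3) * ?sq x + ennreal (c2 * b) * (ennreal (h (\<delta> x)) * indicator B x)"
          unfolding e by (intro add_right_mono) simp
        finally show ?thesis .
      next
        case False
        then have "F x \<le> ennreal c4 * ?sq x" using elim by (intro far) auto
        then show ?thesis unfolding e by (simp add: add_increasing2 add.assoc)
      qed
    qed
    then have "(\<integral>\<^sup>+x. F x \<partial>R) \<le> (\<integral>\<^sup>+x. ennreal (c4 + c2 * a * c3) * ?sq x + ennreal (c2 * b) * (ennreal (h (\<delta> x)) * indicator B x) \<partial>R)"
      by (rule nn_integral_mono_AE)
    also have "\<dots> = ennreal (c4 + c2 * a * c3) * (\<integral>\<^sup>+x. ?sq x \<partial>R) + ennreal (c2 * b) * (\<integral>\<^sup>+x. ennreal (h (\<delta> x)) * indicator B x \<partial>R)"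
      by (subst nn_integral_add) (auto simp: nn_integral_cmult)
    also have "\<dots> < \<infinity>"
      using asm sq_fin by (auto simp: ennreal_mult_less_top)
    finally show "(\<integral>\<^sup>+x. F x \<partial>R) < \<infinity>" .
  qed
  then show ?thesis by (simp add: F_def B_def \<delta>_def)
qed

lemma tail_integral_positive_index_le:
  assumes "0 < \<alpha>" "0 \<le> \<delta>"
  shows "tail_integral p (- \<alpha>) \<delta> 1 \<le> ennreal (1 / \<alpha>)"
proof -
  have "tail_integral p (- \<alpha>) \<delta> 1 \<le> (\<integral>\<^sup>+u\<in>{1<..}. ennreal (u powr (- \<alpha> - 1)) \<partial>lborel)"
    unfolding tail_integral_def using assms
    by (intro nn_integral_mono) (auto split: split_indicator intro!: ennreal_leI mult_left_le_one_le)
  also have "\<dots> \<le> ennreal (1 / \<alpha>)" by (rule nn_integral_powr_tail) fact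
  finally show ?thesis .
qed

text \<open>The exponential factor lies between \<open>exp (- 1)\<close> and \<open>1\<close> up to \<open>T = \<delta> powr (- 1 / p)\<close>, where the
integral of \<open>1 / u\<close> is \<open>\<bar>ln \<delta>\<bar> / p\<close>; beyond \<open>T\<close> scaling leaves a bounded remainder.\<close>

lemma tail_integral_index_zero_bounds:
  assumes p: "0 < p" and \<delta>: "0 < \<delta>" "\<delta> < 1"
  shows "ennreal (exp (- 1) / p) * ennreal \<bar>ln \<delta>\<bar> \<le> tail_integral p 0 \<delta> 1"
    and "tail_integral p 0 \<delta> 1 \<le> tail_integral p 1 1 0 + ennreal (1 / p) * ennreal \<bar>ln \<delta>\<bar>"
proof -
  define T where "T = \<delta> powr (- 1 / p)"
  have lnT: "ln T = \<bar>ln \<delta>\<bar> / p" using \<delta> p by (simp add: T_def ln_powr powr_def)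
  have "0 < ln T" unfolding lnT using \<delta> p by (intro divide_pos_pos) auto
  moreover have "0 < T" using \<delta> by (simp add: T_def)
  ultimately have T: "1 < T" by simp
  have Tp: "\<delta> * T powr p = 1"
  proof -
    have "T powr p = \<delta> powr (- 1 / p * p)" by (simp only: T_def powr_powr)
    then show ?thesis using p \<delta> by (simp add: powr_minus)
  qed
  let ?f = "\<lambda>u. ennreal (exp (- \<delta> * u powr p) * u powr (0 - 1)) * indicator {1<..} u"
  have inv: "u powr (0 - 1) = inverse u" if "0 < u" for u :: real
    using that by (simp add: powr_minus)
  have le1: "\<delta> * u powr p \<le> 1" if "1 < u" "u \<le> T" for u
  proof -
    have "u powr p \<le> T powr p" using that p by (intro powr_mono2) auto
    then show ?thesis using mult_left_mono[of "u powr p" "T powr p" \<delta>] \<delta> Tp by simp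
  qed
  have Ioc: "(\<integral>\<^sup>+u. ennreal (inverse u) * indicator {1<..T} u \<partial>lborel) = ennreal (\<bar>ln \<delta>\<bar> / p)"
  proof -
    have "(\<integral>\<^sup>+u. ennreal (inverse u) * indicator {1<..T} u \<partial>lborel) = (\<integral>\<^sup>+u\<in>{1..T}. ennreal (inverse u) \<partial>lborel)"
      using AE_lborel_singleton[of "1::real"]
      by (intro nn_integral_cong_AE) (auto elim!: eventually_mono split: split_indicator)
    then show ?thesis using nn_integral_inverse_Icc[of T] T lnT by simp
  qed
  have "ennreal (exp (- 1) / p) * ennreal \<bar>ln \<delta>\<bar> = ennreal (exp (- 1)) * (\<integral>\<^sup>+u. ennreal (inverse u) * indicator {1<..T} u \<partial>lborel)"
    unfolding Ioc using p by (simp add: ennreal_mult[symmetric])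
  also have "\<dots> = (\<integral>\<^sup>+u. ennreal (exp (- 1)) * (ennreal (inverse u) * indicator {1<..T} u) \<partial>lborel)"
    by (rule nn_integral_cmult[symmetric]) measurable
  also have "\<dots> \<le> tail_integral p 0 \<delta> 1"
    unfolding tail_integral_def
  proof (intro nn_integral_mono)
    fix u :: real
    show "ennreal (exp (- 1)) * (ennreal (inverse u) * indicator {1<..T} u) \<le> ?f u"
    proof (cases "1 < u \<and> u \<le> T")
      case True
      then have "exp (- 1) * inverse u \<le> exp (- \<delta> * u powr p) * inverse u"
        using le1[of u] by (intro mult_right_mono) auto
      then show ?thesis using True inv[of u] by (simp add: ennreal_mult[symmetric] ennreal_leI)
    qed auto
  qed
  finally show "ennreal (exp (- 1) / p) * ennreal \<bar>ln \<delta>\<bar> \<le> tail_integral p 0 \<delta> 1" .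
  have "tail_integral p 0 \<delta> 1 \<le> (\<integral>\<^sup>+u. ?f u * indicator {T<..} u + ennreal (inverse u) * indicator {1<..T} u \<partial>lborel)"
    unfolding tail_integral_def
  proof (intro nn_integral_mono)
    fix u :: real
    consider "u \<le> 1" | "1 < u" "u \<le> T" | "T < u" by linarith
    then show "?f u \<le> ?f u * indicator {T<..} u + ennreal (inverse u) * indicator {1<..T} u"
    proof cases
      case 2
      then have "exp (- \<delta> * u powr p) * inverse u \<le> inverse u"
        using \<delta> by (intro mult_left_le_one_le) auto
      then show ?thesis using 2 inv[of u] by (simp add: ennreal_leI)
    qed auto
  qed
  also have "\<dots> = (\<integral>\<^sup>+u. ?f u * indicator {T<..} u \<partial>lborel) + ennreal (\<bar>ln \<delta>\<bar> / p)"
    by (subst nn_integral_add) (auto simp: Ioc)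
  also have "(\<integral>\<^sup>+u. ?f u * indicator {T<..} u \<partial>lborel) \<le> tail_integral p 0 \<delta> T"
    unfolding tail_integral_def by (intro nn_integral_mono) (auto split: split_indicator)
  also have "tail_integral p 0 \<delta> T = tail_integral p 0 1 (T * \<delta> powr (1 / p))"
    using tail_integral_scale[OF p \<delta>(1), of T 0] T \<delta> by simp
  also have "T * \<delta> powr (1 / p) = 1"
    unfolding T_def using \<delta> by (simp add: powr_add[symmetric])
  also have "tail_integral p 0 1 1 \<le> tail_integral p 1 1 0"
    by (rule order_trans[OF tail_integral_mono_exponent tail_integral_antimono]) auto
  finally show "tail_integral p 0 \<delta> 1 \<le> tail_integral p 1 1 0 + ennreal (1 / p) * ennreal \<bar>ln \<delta>\<bar>"
    using p by (simp add: add_right_mono ennreal_mult[symmetric])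
qed

section \<open>Exponential moments of tempered stable laws\<close>

lemma powr_subadditive:
  fixes a b p :: real
  assumes "0 \<le> a" "0 \<le> b" "0 < p" "p \<le> 1"
  shows "(a + b) powr p \<le> a powr p + b powr p"
proof (cases "a + b = 0")
  case False
  then have s: "0 < a + b" using assms by auto
  have *: "x / (a + b) * (a + b) powr p \<le> x powr p" if "0 \<le> x" "x \<le> a + b" for x
  proof -
    have "x / (a + b) \<le> (x / (a + b)) powr p"
      using powr_mono'[of p 1 "x / (a + b)"] that s assms by simp
    then have "x / (a + b) * (a + b) powr p \<le> (x / (a + b)) powr p * (a + b) powr p"
      by (rule mult_right_mono) simp
    also have "\<dots> = x powr p" using that s by (simp add: powr_mult[symmetric])
    finally show ?thesis .
  qed
  have "(a + b) powr p = a / (a + b) * (a + b) powr p + b / (a + b) * (a + b) powr p"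
    using s by (simp add: distrib_right[symmetric] add_divide_distrib[symmetric])
  also have "\<dots> \<le> a powr p + b powr p" using assms by (intro add_mono *) auto
  finally show ?thesis .
qed (use assms in auto)

lemma submultiplicative_weight_exp_powr:
  assumes "0 < \<theta>" "0 < p" "p \<le> 1"
  shows "submultiplicative_weight (\<lambda>x::'a::euclidean_space. exp (\<theta> * norm x powr p)) (exp \<theta>) \<theta>"
proof
  fix x y :: 'a
  have "norm (x + y) powr p \<le> (norm x + norm y) powr p"
    using assms by (intro powr_mono2 norm_triangle_ineq) auto
  also have "\<dots> \<le> norm x powr p + norm y powr p"
    by (rule powr_subadditive) (use assms in auto)
  finally show "exp (\<theta> * norm (x + y) powr p) \<le> exp (\<theta> * norm x powr p) * exp (\<theta> * norm y powr p)"
    using assms by (simp add: exp_add[symmetric] distrib_left[symmetric])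
  have "norm x powr p \<le> 1 + norm x"
  proof (cases "norm x \<le> 1")
    case True
    then have "norm x powr p \<le> 1 powr p" using assms by (intro powr_mono2) auto
    then show ?thesis by (simp add: add_increasing2)
  next
    case False
    then have "norm x powr p \<le> norm x powr 1" using assms by (intro powr_mono) auto
    then show ?thesis using False by simp
  qed
  then have "\<theta> * norm x powr p \<le> \<theta> * (1 + norm x)"
    using assms by (intro mult_left_mono) auto
  then show "exp (\<theta> * norm x powr p) \<le> exp \<theta> * exp (\<theta> * norm x)"
    by (simp add: exp_add[symmetric] distrib_left)
qed (use assms in auto)

lemma tempered_stable_moment_iff:
  fixes R \<mu> :: "'a::euclidean_space measure"
  assumes "0 < p" "p \<le> 1" "0 < \<theta>" and TS: "is_TS p \<alpha> R b \<mu>"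
  shows "(\<integral>\<^sup>+x. ennreal (exp (\<theta> * norm x powr p)) \<partial>\<mu>) < \<infinity> \<longleftrightarrow>
    (\<integral>\<^sup>+x. ennreal (norm x powr \<alpha>) * tail_integral p (- \<alpha>) (norm x powr (- p) - \<theta>) 1 \<partial>R) < \<infinity>"
proof -
  interpret submultiplicative_weight "\<lambda>x::'a. exp (\<theta> * norm x powr p)" "exp \<theta>" \<theta>
    by (rule submultiplicative_weight_exp_powr) fact+
  have id: "is_ID0 (TS_levy p \<alpha> R) b \<mu>" and sets: "sets R = sets borel"
    using TS by (auto simp: is_TS_def rosinski_measure_def)
  have m: "(\<lambda>x::'a. ennreal (exp (\<theta> * norm x powr p)) * indicator {x. 1 < norm x} x) \<in> borel_measurable borel"
    by measurable
  show ?thesis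
    unfolding infinitely_divisible_moment_iff[OF id] nn_integral_TS_levy[OF sets m]
      jump_integral_along_ray[OF assms(1)] ..
qed

theorem theorem14:
  fixes \<alpha> p \<theta> :: real
    and \<mu> R :: "'a::euclidean_space measure"
    and b :: 'a
  assumes "\<alpha> < 2" and "0 < p" and "p \<le> 1" and "0 < \<theta>"
    and "is_TS p \<alpha> R b \<mu>"
  shows
    "(0 < \<alpha> \<longrightarrow>
        ((\<integral>\<^sup>+x. ennreal (exp (\<theta> * norm x powr p)) \<partial>\<mu>) < \<infinity> \<longleftrightarrow>
         emeasure R {x. norm x > \<theta> powr (-1 / p)} = 0)) \<and>
     (\<alpha> < 0 \<longrightarrow>
        ((\<integral>\<^sup>+x. ennreal (exp (\<theta> * norm x powr p)) \<partial>\<mu>) < \<infinity> \<longleftrightarrow>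
         emeasure R {x. norm x \<ge> \<theta> powr (-1 / p)} = 0 \<and>
         (\<integral>\<^sup>+x\<in>{x. 0 < norm x powr (-p) - \<theta> \<and> norm x powr (-p) - \<theta> < 1}.
            ennreal ((norm x powr (-p) - \<theta>) powr (\<alpha> / p)) \<partial>R) < \<infinity>)) \<and>
     (\<alpha> = 0 \<longrightarrow>
        ((\<integral>\<^sup>+x. ennreal (exp (\<theta> * norm x powr p)) \<partial>\<mu>) < \<infinity> \<longleftrightarrow>
         emeasure R {x. norm x \<ge> \<theta> powr (-1 / p)} = 0 \<and>
         (\<integral>\<^sup>+x\<in>{x. 0 < norm x powr (-p) - \<theta> \<and> norm x powr (-p) - \<theta> < 1}.
            ennreal \<bar>ln (norm x powr (-p) - \<theta>)\<bar> \<partial>R) < \<infinity>))"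
proof -
  note \<alpha> = assms(1) and p = assms(2) and \<theta> = assms(4)
  have R: "rosinski_measure \<alpha> R" using assms(5) by (simp add: is_TS_def)
  have \<rho>: "0 < \<theta> powr (- 1 / p)" using \<theta> by simp
  have out: "{x::'a. x \<noteq> 0 \<and> norm x powr (- p) - \<theta> \<in> {..<0}} = {x. norm x > \<theta> powr (- 1 / p)}"
    (is "?A = ?B")
  proof (rule set_eqI)
    fix x :: 'a
    show "x \<in> ?A \<longleftrightarrow> x \<in> ?B"
      using powr_neg_less_iff(1)[OF p _ \<theta>, of "norm x"] \<rho> by (cases "x = 0") auto
  qed
  have out_eq: "{x::'a. x \<noteq> 0 \<and> norm x powr (- p) - \<theta> \<in> {..0}} = {x. norm x \<ge> \<theta> powr (- 1 / p)}"
    (is "?A = ?B")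
  proof (rule set_eqI)
    fix x :: 'a
    show "x \<in> ?A \<longleftrightarrow> x \<in> ?B"
      using powr_neg_less_iff(2)[OF p _ \<theta>, of "norm x"] \<rho> by (cases "x = 0") auto
  qed
  note iff = tempered_stable_moment_iff[OF p assms(3) \<theta> assms(5)]
  show ?thesis
  proof (intro conjI impI)
    assume \<alpha>0: "0 < \<alpha>"
    show "(\<integral>\<^sup>+x. ennreal (exp (\<theta> * norm x powr p)) \<partial>\<mu>) < \<infinity> \<longleftrightarrow>
         emeasure R {x. norm x > \<theta> powr (-1 / p)} = 0"
      unfolding iff out[symmetric]
      using tempered_moment_criterion[OF \<alpha> p \<theta> R, of "\<lambda>_. 0" "{..<0}" "1 / \<alpha>" 0 1]
        tail_integral_infinite[OF p] tail_integral_positive_index_le[OF \<alpha>0] \<alpha>0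
      by simp
  next
    assume \<alpha>0: "\<alpha> < 0"
    obtain G where G: "tail_integral p (- \<alpha>) 1 0 = ennreal G" "0 \<le> G"
      using tail_integral_finite[OF p, of "- \<alpha>"] \<alpha>0 by (cases "tail_integral p (- \<alpha>) 1 0") auto
    have G1: "tail_integral p (- \<alpha>) 1 1 \<le> ennreal G"
      using tail_integral_antimono[of 0 1 p "- \<alpha>" 1] by (simp add: G(1))
    then obtain L where L: "tail_integral p (- \<alpha>) 1 1 = ennreal L" "0 \<le> L"
      by (cases "tail_integral p (- \<alpha>) 1 1") (auto simp: top_unique)
    have L0: "0 < L" using tail_integral_pos[of p "- \<alpha>"] L by (cases "L = 0") auto
    have sc: "tail_integral p (- \<alpha>) \<delta> 1 = ennreal (\<delta> powr (\<alpha> / p)) * tail_integral p (- \<alpha>) 1 (\<delta> powr (1 / p))" if "0 < \<delta>" for \<delta>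
      using tail_integral_scale[OF p that, of 1 "- \<alpha>"] by simp
    show "(\<integral>\<^sup>+x. ennreal (exp (\<theta> * norm x powr p)) \<partial>\<mu>) < \<infinity> \<longleftrightarrow>
         emeasure R {x. norm x \<ge> \<theta> powr (-1 / p)} = 0 \<and>
         (\<integral>\<^sup>+x\<in>{x. 0 < norm x powr (-p) - \<theta> \<and> norm x powr (-p) - \<theta> < 1}.
            ennreal ((norm x powr (-p) - \<theta>) powr (\<alpha> / p)) \<partial>R) < \<infinity>"
      unfolding iff out_eq[symmetric]
    proof (rule tempered_moment_criterion[OF \<alpha> p \<theta> R, where a = 0 and b = G and c = L])
      show "tail_integral p (- \<alpha>) \<delta> 1 = \<infinity>" if "\<delta> \<in> {..0}" for \<delta>
        using that \<alpha>0 by (intro tail_integral_infinite[OF p]) auto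
      show "tail_integral p (- \<alpha>) \<delta> 1 \<le> ennreal 0 + ennreal G * ennreal (\<delta> powr (\<alpha> / p)) * indicator {0<..} \<delta>"
        if "\<delta> \<notin> {..0}" for \<delta>
        using that mult_left_mono[OF tail_integral_antimono[of 0 "\<delta> powr (1 / p)" p "- \<alpha>" 1], of "ennreal (\<delta> powr (\<alpha> / p))"]
        by (simp add: sc G(1) mult.commute)
      show "ennreal L * ennreal (\<delta> powr (\<alpha> / p)) \<le> tail_integral p (- \<alpha>) \<delta> 1" if "0 < \<delta>" "\<delta> < 1" for \<delta>
      proof -
        have "\<delta> powr (1 / p) \<le> 1 powr (1 / p)" using that p by (intro powr_mono2) auto
        then have "tail_integral p (- \<alpha>) 1 1 \<le> tail_integral p (- \<alpha>) 1 (\<delta> powr (1 / p))"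
          by (intro tail_integral_antimono) simp
        then have "ennreal L * ennreal (\<delta> powr (\<alpha> / p)) \<le> tail_integral p (- \<alpha>) 1 (\<delta> powr (1 / p)) * ennreal (\<delta> powr (\<alpha> / p))"
          unfolding L(1) by (rule mult_right_mono) simp
        then show ?thesis using that by (simp add: sc mult.commute)
      qed
    qed (use G L0 in auto)
  next
    assume \<alpha>0: "\<alpha> = 0"
    obtain G where G: "tail_integral p 1 1 0 = ennreal G" "0 \<le> G"
      using tail_integral_finite[OF p, of 1] by (cases "tail_integral p 1 1 0") auto
    show "(\<integral>\<^sup>+x. ennreal (exp (\<theta> * norm x powr p)) \<partial>\<mu>) < \<infinity> \<longleftrightarrow>
         emeasure R {x. norm x \<ge> \<theta> powr (-1 / p)} = 0 \<and>
         (\<integral>\<^sup>+x\<in>{x. 0 < norm x powr (-p) - \<theta> \<and> norm x powr (-p) - \<theta> < 1}.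
            ennreal \<bar>ln (norm x powr (-p) - \<theta>)\<bar> \<partial>R) < \<infinity>"
      unfolding iff out_eq[symmetric]
    proof (rule tempered_moment_criterion[OF \<alpha> p \<theta> R, where a = G and b = "1 / p" and c = "exp (- 1) / p"])
      show "tail_integral p (- \<alpha>) \<delta> 1 = \<infinity>" if "\<delta> \<in> {..0}" for \<delta>
        using that \<alpha>0 by (intro tail_integral_infinite[OF p]) auto
      show "tail_integral p (- \<alpha>) \<delta> 1 \<le> ennreal G + ennreal (1 / p) * ennreal \<bar>ln \<delta>\<bar> * indicator {0<..} \<delta>"
        if "\<delta> \<notin> {..0}" "\<delta> < 1" for \<delta>
        using that tail_integral_index_zero_bounds(2)[OF p, of \<delta>] by (simp add: \<alpha>0 G(1))
      show "ennreal (exp (- 1) / p) * ennreal \<bar>ln \<delta>\<bar> \<le> tail_integral p (- \<alpha>) \<delta> 1" if "0 < \<delta>" "\<delta> < 1" for \<delta>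
        using tail_integral_index_zero_bounds(1)[OF p that] by (simp add: \<alpha>0)
    qed (use G p in auto)
  qed
qed

end
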